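(* Let $1\leq p < \infty$ and $w \in A_p$. There are constants $C_1,C_2>0$ such that for every $a \in \mathbb{R}^n$ and $r>0$: if $1<p<\infty$, then $$\|Mf\|_{L^{p,w}(B(a,r))} \leq C_1\, w(B(a,r))^{\frac{1}{p}} \sup_{r < t < \infty} w(B(a,t))^{-\frac{1}{p}} \|f\|_{L^{p,w}(B(a,t))}\quad\text{for all } f \in L_{loc}^{p,w};$$ and $$\|Mf\|_{WL^{1,w}(B(a,r))} \le C_2\, w(B(a,r)) \sup_{r < t < \infty} w(B(a,t))^{-1} \|f\|_{L^{1,w}(B(a,t))}\quad\text{for all } f\in L_{loc}^{1,w}.$$
   Context: $M$ is the Hardy–Littlewood maximal operator $Mf(x)=\sup_{r>0}\frac{1}{|B(x,r)|}\int_{B(x,r)}|f(y)|\,dy$. $B(a,r)$ is the open ball, $w(E)=\int_E w$. For $1<p<\infty$, $A_p$ is the set of weights $w$ (nonnegative locally integrable, positive a.e.) with $\left(\frac{1}{|B|}\int_B w\right)\left(\frac{1}{|B|}\int_B w^{-\frac{1}{p-1}}\right)^{p-1}\le C$ for all balls $B$; $A_1$ is the set of weights with $\frac{1}{|B|}\int_B w\cdot\|w^{-1}\|_{L^\infty(B)}\le C$ for all balls $B$. For measurable $\Omega$: $\|f\|_{L^{p,w}(\Omega)}=\left(\int_\Omega |f|^p w\right)^{1/p}$ and $\|f\|_{WL^{p,w}(\Omega)}=\sup_{\gamma>0}\gamma\, w(\{x\in\Omega:|f(x)|>\gamma\})^{1/p}$. $L^{p,w}_{loc}$ is the set of measurable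 $f$ with $\|f\chi_B\|_{L^{p,w}}<\infty$ for every ball $B$.
   Formalization: The weak estimate in WL^{1,w} is stated only for p = 1, that is for w in A_1; for w in A_p with p > 1 it fails in general, e.g. w(x) = |x|^{1/2} on R with f = (2ε)^{-1} times the indicator of (-ε,ε), a = 0, r = 1, ε → 0. *)

theory Defs
  imports "HOL-Analysis.Analysis" "HOL-Probability.Essential_Supremum"
begin

definition epowr :: "ennreal \<Rightarrow> real \<Rightarrow> ennreal" (infixr "epowr" 80) where
  "x epowr q =
     (if q = 0 then 1
      else if x = \<infinity> then (if q > 0 then \<infinity> else 0)
      else if x = 0 then (if q > 0 then 0 else \<infinity>)
      else ennreal (enn2real x powr q))"

definition maxfun :: "('a::euclidean_space \<Rightarrow> real) \<Rightarrow> 'a \<Rightarrow> ennreal" where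
  "maxfun f x = (SUP r\<in>{0<..}. (\<integral>\<^sup>+ y\<in>ball x r. ennreal \<bar>f y\<bar> \<partial>lebesgue)
                                  / emeasure lebesgue (ball x r))"

definition wmeas :: "('a::euclidean_space \<Rightarrow> real) \<Rightarrow> 'a set \<Rightarrow> ennreal" where
  "wmeas w E = (\<integral>\<^sup>+ x\<in>E. ennreal (w x) \<partial>lebesgue)"

definition eavg :: "'a::euclidean_space set \<Rightarrow> ('a \<Rightarrow> ennreal) \<Rightarrow> ennreal" where
  "eavg B g = (\<integral>\<^sup>+ x\<in>B. g x \<partial>lebesgue) / emeasure lebesgue B"

definition weight :: "('a::euclidean_space \<Rightarrow> real) \<Rightarrow> bool" where
  "weight w \<longleftrightarrow> (\<forall>x. 0 \<le> w x) \<and> w \<in> borel_measurable lebesgue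
     \<and> (\<forall>c \<rho>. set_integrable lebesgue (ball c \<rho>) w)
     \<and> (AE x in lebesgue. 0 < w x)"

definition Ap_class :: "real \<Rightarrow> ('a::euclidean_space \<Rightarrow> real) set" where
  "Ap_class p = {w. weight w \<and>
     (if p = 1 then
        (\<exists>C::real. \<forall>c \<rho>. \<rho> > 0 \<longrightarrow>
           eavg (ball c \<rho>) (\<lambda>x. ennreal (w x))
             * esssup (restrict_space lebesgue (ball c \<rho>)) (\<lambda>x. inverse (ennreal (w x)))
           \<le> ennreal C)
      else
        (\<exists>C::real. \<forall>c \<rho>. \<rho> > 0 \<longrightarrow>
           eavg (ball c \<rho>) (\<lambda>x. ennreal (w x))
             * (eavg (ball c \<rho>) (\<lambda>x. ennreal (w x) epowr (- 1 / (p - 1)))) epowr (p - 1)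
           \<le> ennreal C))}"

text \<open>Weighted L^p norm over \<Omega> of an extended nonnegative function g (for real f use |f|).\<close>
definition Lpw_norm :: "real \<Rightarrow> ('a::euclidean_space \<Rightarrow> real) \<Rightarrow> 'a set \<Rightarrow> ('a \<Rightarrow> ennreal) \<Rightarrow> ennreal" where
  "Lpw_norm p w \<Omega> g = (\<integral>\<^sup>+ x\<in>\<Omega>. (g x epowr p) * ennreal (w x) \<partial>lebesgue) epowr (1 / p)"

definition WLpw_norm :: "real \<Rightarrow> ('a::euclidean_space \<Rightarrow> real) \<Rightarrow> 'a set \<Rightarrow> ('a \<Rightarrow> ennreal) \<Rightarrow> ennreal" where
  "WLpw_norm p w \<Omega> g = (SUP \<gamma>\<in>{0<..}. ennreal \<gamma> * (wmeas w {x\<in>\<Omega>. g x > ennreal \<gamma>}) epowr (1 / p))"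

definition Lpw_loc :: "real \<Rightarrow> ('a::euclidean_space \<Rightarrow> real) \<Rightarrow> ('a \<Rightarrow> real) set" where
  "Lpw_loc p w = {f. f \<in> borel_measurable lebesgue \<and>
     (\<forall>c \<rho>. Lpw_norm p w (ball c \<rho>) (\<lambda>x. ennreal \<bar>f x\<bar>) < \<infinity>)}"

end

theory Submission
  imports Defs
begin

text \<open>
  Both classes \<open>A\<^sub>p\<close> yield the averaging inequality
  \<open>w(B)\<^bsup>1/p\<^esup> \<integral>\<^sub>B F \<le> K |B| (\<integral>\<^sub>B F\<^bsup>p\<^esup> w)\<^bsup>1/p\<^esup>\<close>, which makes \<open>w\<close> doubling and, for points of
  \<open>B(a,r)\<close>, bounds averages over balls of radius comparable to or larger than \<open>r\<close> by the
  supremum on the right-hand side of the theorem. What remains is the maximal function of \<open>f\<close>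
  restricted to \<open>B(a,5r)\<close>, for which one needs the global weighted bounds. For \<open>p = 1\<close> the averaging
  inequality says \<open>M f \<le> K M\<^sub>w f\<close> for the uncentred maximal operator \<open>M\<^sub>w\<close> of the doubling measure
  \<open>w dx\<close>, which is of weak type (1,1) by Vitali's covering lemma. For \<open>p > 1\<close>, Lerner's argument with
  \<open>v = w\<^bsup>-1/(p-1)\<^esup>\<close> gives \<open>(M f)\<^bsup>p-1\<^esup> \<le> K\<^bsup>p\<^esup> M\<^sub>w((M\<^sub>v(f/v))\<^bsup>p-1\<^esup> / w)\<close> and avoids the reverse Hoelder inequality.
\<close>

subsection \<open>Powers of extended nonnegative reals\<close>

lemma epowr_ennreal: "0 < t \<Longrightarrow> ennreal t epowr q = ennreal (t powr q)"
  by (auto simp: epowr_def)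

lemma epowr_ennreal_pos: "0 \<le> t \<Longrightarrow> 0 < q \<Longrightarrow> ennreal t epowr q = ennreal (t powr q)"
  by (cases "t = 0") (auto simp: epowr_def)

lemma epowr_zero [simp]: "0 < q \<Longrightarrow> 0 epowr q = 0"
  by (auto simp: epowr_def)

lemma epowr_top [simp]: "0 < q \<Longrightarrow> top epowr q = top"
  by (auto simp: epowr_def)

lemma epowr_one [simp]: "x epowr 1 = x"
  by (cases x) (auto simp: epowr_ennreal_pos)

lemma one_epowr [simp]: "1 epowr q = 1"
  using epowr_ennreal[of 1 q] by simp

lemma epowr_mono: "0 < q \<Longrightarrow> x \<le> y \<Longrightarrow> x epowr q \<le> y epowr q"
  by (cases x; cases y) (auto simp: epowr_ennreal_pos powr_mono2 top_unique)

lemma epowr_eq_0_iff: "0 < q \<Longrightarrow> x epowr q = 0 \<longleftrightarrow> x = 0"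
  by (cases x) (auto simp: epowr_ennreal_pos)

text \<open>With \<open>0 * \<infinity> = 0\<close>, a vanishing factor makes both sides 0, and
  otherwise an infinite factor makes both sides infinite; both facts depend on
  \<open>q > 0\<close>.\<close>

lemma epowr_mult:
  assumes "0 < q"
  shows "(x * y) epowr q = x epowr q * y epowr q"
proof -
  consider "x = 0 \<or> y = 0" | "x \<noteq> 0" "y \<noteq> 0" "x = top \<or> y = top"
    | s t where "0 \<le> s" "0 \<le> t" "x = ennreal s" "y = ennreal t"
    by (cases x; cases y) auto
  then show ?thesis
  proof cases
    case 2
    moreover have "x epowr q \<noteq> 0" "y epowr q \<noteq> 0"
      using 2 assms by (auto simp: epowr_eq_0_iff)
    ultimately show ?thesis
      using assms by (auto simp: ennreal_mult_top ennreal_top_mult)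
  next
    case 3
    then show ?thesis
      using assms by (simp add: epowr_ennreal_pos powr_mult flip: ennreal_mult)
  qed (use assms in auto)
qed

lemma epowr_epowr: "0 < a \<Longrightarrow> 0 < b \<Longrightarrow> (x epowr a) epowr b = x epowr (a * b)"
  by (cases x) (auto simp: epowr_ennreal_pos powr_powr)

lemma epowr_root: "0 < q \<Longrightarrow> (x epowr q) epowr (1 / q) = x"
  by (simp add: epowr_epowr)

lemma root_epowr: "0 < q \<Longrightarrow> (x epowr (1 / q)) epowr q = x"
  by (simp add: epowr_epowr)

lemma epowr_add: "0 < a \<Longrightarrow> 0 < b \<Longrightarrow> x epowr (a + b) = x epowr a * x epowr b"
  by (cases x) (auto simp: epowr_ennreal_pos powr_add ennreal_mult)

lemma epowr_minus: "0 < q \<Longrightarrow> x epowr (- q) = inverse (x epowr q)"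
  by (cases x; cases "x = 0") (auto simp: epowr_def powr_minus inverse_ennreal)

lemma epowr_eq_top_iff: "0 < q \<Longrightarrow> x epowr q = top \<longleftrightarrow> x = top"
  by (auto simp: epowr_def split: if_splits)

lemma borel_measurable_epowr [measurable]:
  assumes [measurable]: "f \<in> borel_measurable M"
  shows "(\<lambda>x. f x epowr q) \<in> borel_measurable M"
  unfolding epowr_def by measurable

text \<open>The layer-cake formula, stated for a single value \<open>x\<close> so that Fubini's
  theorem later turns the integral of a power into an integral over superlevel sets. An infinite
  \<open>x\<close> is handled by comparison with all finite values.\<close>

lemma nn_integral_powr_layer:
  assumes "0 < s"
  shows "(\<integral>\<^sup>+ l. ennreal (l powr (s - 1)) * indicator {l. 0 < l \<and> ennreal l < x} l \<partial>lborel)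
    = ennreal (1 / s) * x epowr s"
proof -
  have fin: "(\<integral>\<^sup>+ l. ennreal (l powr (s - 1)) * indicator {l. 0 < l \<and> ennreal l < ennreal t} l \<partial>lborel)
    = ennreal (1 / s) * ennreal t epowr s" (is "?L t = _") if t: "0 \<le> t" for t
  proof -
    have "?L t = (\<integral>\<^sup>+ l. ennreal (l powr (s - 1) * indicator {0..t} l) \<partial>lborel)"
    proof (rule nn_integral_cong_AE)
      \<comment> \<open>The open and the closed interval differ only in their endpoints, a null
        set.\<close>
      have "AE l in lborel. l \<noteq> t \<and> l \<noteq> (0::real)"
        by (intro AE_conjI AE_lborel_singleton)
      then show "AE l in lborel. ennreal (l powr (s - 1)) * indicator {l. 0 < l \<and> ennreal l < ennreal t} l
         = ennreal (l powr (s - 1) * indicator {0..t} l)"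
        by eventually_elim (auto simp: indicator_def ennreal_less_iff)
    qed
    also have "\<dots> = ennreal (t powr s / s)"
    proof (rule nn_integral_has_integral_lborel)
      have "((\<lambda>l. l powr (s - 1)) has_integral (t powr (s - 1 + 1) / (s - 1 + 1))) {0..t}"
        using assms t by (intro has_integral_powr_from_0) auto
      then have "((\<lambda>l. if l \<in> {0..t} then l powr (s - 1) else 0) has_integral (t powr s / s)) UNIV"
        by (subst has_integral_restrict_UNIV) simp
      then show "((\<lambda>l. l powr (s - 1) * indicator {0..t} l) has_integral (t powr s / s)) UNIV"
        by (rule has_integral_eq_rhs[OF has_integral_eq, rotated 1]) (auto simp: indicator_def)
    qed auto
    finally show ?thesis
      using assms t by (simp add: epowr_ennreal_pos flip: ennreal_mult)
  qed
  show ?thesis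
  proof (cases x)
    case (real t)
    then show ?thesis using fin[of t] by simp
  next
    case top
    let ?I = "\<integral>\<^sup>+ l. ennreal (l powr (s - 1)) * indicator {l. 0 < l \<and> ennreal l < x} l \<partial>lborel"
    have le: "ennreal (1 / s) * ennreal t epowr s \<le> ?I" if "0 \<le> t" for t
      by (subst fin[OF that, symmetric]) (auto intro!: nn_integral_mono simp: top indicator_def)
    have "?I = top"
    proof (rule ccontr)
      assume "?I \<noteq> top"
      then obtain m where m: "0 \<le> m" "?I = ennreal m"
        by (cases ?I rule: ennreal_cases) blast+
      \<comment> \<open>A value whose contribution \<open>t powr s / s\<close> equals
        \<open>m + 1\<close>, more than the assumed finite integral \<open>m\<close>.\<close>
      define t where "t = (s * (m + 1)) powr (1 / s)"
      have "t powr s = s * (m + 1)"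
        using assms m by (simp add: t_def powr_powr)
      then have "ennreal (1 / s) * ennreal t epowr s = ennreal (m + 1)"
        using assms m by (simp add: epowr_ennreal_pos t_def flip: ennreal_mult)
      then show False
        using le[of t] m by (simp add: t_def)
    qed
    then show ?thesis using assms top by (simp add: ennreal_mult_top)
  qed
qed

text \<open>Both functions are scaled to norm one and Young's inequality is integrated; norms equal
  to 0 or \<infinity> cannot be scaled and form separate cases.\<close>

lemma nn_integral_Holder:
  assumes pq: "1 < p" "1 < q" "1 / p + 1 / q = 1"
    and [measurable]: "F \<in> borel_measurable M" "G \<in> borel_measurable M"
  shows "(\<integral>\<^sup>+ x. F x * G x \<partial>M)
    \<le> (\<integral>\<^sup>+ x. F x epowr p \<partial>M) epowr (1 / p) * (\<integral>\<^sup>+ x. G x epowr q \<partial>M) epowr (1 / q)"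
proof -
  define A where "A = (\<integral>\<^sup>+ x. F x epowr p \<partial>M)"
  define B where "B = (\<integral>\<^sup>+ x. G x epowr q \<partial>M)"
  have young: "x * y \<le> ennreal (1 / p) * x epowr p + ennreal (1 / q) * y epowr q" for x y :: ennreal
  proof (cases "x = top \<or> y = top")
    case True
    then show ?thesis using pq by (auto simp: ennreal_mult_top)
  next
    case False
    then obtain s t where "0 \<le> s" "0 \<le> t" "x = ennreal s" "y = ennreal t"
      by (metis ennreal_cases)
    moreover have "s * t \<le> s powr p / p + t powr q / q"
      using Youngs_inequality[of p q s t] pq calculation by simp
    ultimately show ?thesis
      using pq by (simp add: epowr_ennreal_pos flip: ennreal_mult ennreal_plus)
  qed
  \<comment> \<open>If the other norm is infinite, the bound reads
    \<open>0 * \<infinity> = 0\<close>, so a null norm must force the product to vanish almost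
    everywhere.\<close>
  have zero: "(\<integral>\<^sup>+ x. F x * G x \<partial>M) = 0" if "A = 0 \<or> B = 0"
  proof -
    have "AE x in M. F x epowr p = 0 \<or> G x epowr q = 0"
      using that unfolding A_def B_def by (subst (asm) (1 2) nn_integral_0_iff_AE) auto
    then have "AE x in M. F x * G x = 0"
      using pq by (auto simp: epowr_eq_0_iff)
    then show ?thesis by (subst nn_integral_0_iff_AE) auto
  qed
  consider "A = 0 \<or> B = 0" | "A \<noteq> 0" "B \<noteq> 0" "A = top \<or> B = top"
    | a b where "0 < a" "0 < b" "A = ennreal a" "B = ennreal b"
    by (cases A; cases B) (auto simp: less_le)
  then show ?thesis
  proof cases
    case 1
    then show ?thesis using zero by simp
  next
    case 2
    then have "A epowr (1 / p) * B epowr (1 / q) = top"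
      using pq by (auto simp: ennreal_mult_eq_top_iff epowr_eq_0_iff epowr_eq_top_iff)
    then show ?thesis by (simp add: A_def B_def)
  next
    case 3
    \<comment> \<open>With these factors the integrals of the \<open>p\<close>-th power of
      \<open>c * F\<close> and of the \<open>q\<close>-th power of \<open>d * G\<close> are both
      1.\<close>
    define c where "c = 1 / a powr (1 / p)"
    define d where "d = 1 / b powr (1 / q)"
    have cd: "0 < c" "0 < d" "c powr p = 1 / a" "d powr q = 1 / b"
      using 3 pq by (auto simp: c_def d_def powr_divide powr_powr)
    have "ennreal (c * d) * (\<integral>\<^sup>+ x. F x * G x \<partial>M) = (\<integral>\<^sup>+ x. (ennreal c * F x) * (ennreal d * G x) \<partial>M)"
      using cd by (simp add: nn_integral_cmult[symmetric] ennreal_mult mult_ac)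
    also have "\<dots> \<le> (\<integral>\<^sup>+ x. ennreal (1 / p) * (ennreal c * F x) epowr p
        + ennreal (1 / q) * (ennreal d * G x) epowr q \<partial>M)"
      by (intro nn_integral_mono young)
    also have "\<dots> = (\<integral>\<^sup>+ x. ennreal (1 / p / a) * F x epowr p
        + ennreal (1 / q / b) * G x epowr q \<partial>M)"
      using pq cd 3 by (simp add: epowr_mult epowr_ennreal mult.assoc[symmetric] flip: ennreal_mult)
    also have "\<dots> = ennreal (1 / p / a) * A + ennreal (1 / q / b) * B"
      unfolding A_def B_def by (subst nn_integral_add) (auto simp: nn_integral_cmult)
    also have "\<dots> = ennreal (1 / p + 1 / q)"
      using 3 pq by (simp add: flip: ennreal_mult ennreal_plus)
    finally have *: "ennreal (c * d) * (\<integral>\<^sup>+ x. F x * G x \<partial>M) \<le> 1" using pq by simp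
    have "(\<integral>\<^sup>+ x. F x * G x \<partial>M) = ennreal (1 / (c * d)) * (ennreal (c * d) * (\<integral>\<^sup>+ x. F x * G x \<partial>M))"
      using cd by (simp add: mult.assoc[symmetric] flip: ennreal_mult)
    also have "\<dots> \<le> ennreal (1 / (c * d)) * 1"
      by (intro mult_left_mono *) auto
    also have "\<dots> = A epowr (1 / p) * B epowr (1 / q)"
      using 3 cd by (simp add: epowr_ennreal c_def d_def flip: ennreal_mult)
    finally show ?thesis by (simp add: A_def B_def)
  qed
qed

subsection \<open>Maximal functions of doubling measures\<close>

text \<open>Uncentred: every ball containing \<open>x\<close> competes. This makes superlevel sets
  open for arbitrary \<open>g\<close>, and an average over a ball is bounded by the value at each of
  its points.\<close>

definition umax :: "'a::euclidean_space measure \<Rightarrow> ('a \<Rightarrow> ennreal) \<Rightarrow> 'a \<Rightarrow> ennreal" where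
  "umax M g x = (SUP (c, r) \<in> {(c, r). x \<in> ball c r}. (\<integral>\<^sup>+ y\<in>ball c r. g y \<partial>M) / emeasure M (ball c r))"

text \<open>The factor 5 is the dilation in Vitali's covering lemma.\<close>

locale doubling_measure =
  fixes M :: "'a::euclidean_space measure" and D :: real
  assumes sets_M: "sets M = sets lebesgue"
    and ball_pos: "0 < r \<Longrightarrow> 0 < emeasure M (ball c r)"
    and ball_finite: "emeasure M (ball c r) < \<infinity>"
    and doubling: "0 < r \<Longrightarrow> emeasure M (ball c (5 * r)) \<le> ennreal D * emeasure M (ball c r)"
begin

section \<open>Sigma-finiteness and open superlevel sets\<close>

lemma space_M: "space M = UNIV"
  using sets_eq_imp_space_eq[OF sets_M] by simp

lemma open_sets_M: "open S \<Longrightarrow> S \<in> sets M"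
  by (simp add: sets_M borel_open)

lemma ball_sets_M [measurable, simp]: "ball c r \<in> sets M"
  by (simp add: sets_M)

lemma sigma_finite: "sigma_finite_measure M"
proof
  show "\<exists>A. countable A \<and> A \<subseteq> sets M \<and> \<Union>A = space M \<and> (\<forall>a\<in>A. emeasure M a \<noteq> \<infinity>)"
  proof (intro exI conjI)
    show "countable (range (\<lambda>n. ball (0::'a) (real n)))" by simp
    show "\<Union> (range (\<lambda>n. ball (0::'a) (real n))) = space M"
      by (auto simp: space_M intro: reals_Archimedean2)
    show "\<forall>a\<in>range (\<lambda>n. ball (0::'a) (real n)). emeasure M a \<noteq> \<infinity>"
      using ball_finite by (auto simp: less_top)
  qed auto
qed

lemma average_le_umax:
  "x \<in> ball c r \<Longrightarrow> (\<integral>\<^sup>+ y\<in>ball c r. g y \<partial>M) \<le> umax M g x * emeasure M (ball c r)"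
proof -
  assume x: "x \<in> ball c r"
  then have r: "0 < r" by (metis ball_eq_empty empty_iff not_le)
  have "(\<integral>\<^sup>+ y\<in>ball c r. g y \<partial>M) / emeasure M (ball c r) \<le> umax M g x"
    unfolding umax_def by (rule SUP_upper2[of "(c, r)"]) (use x in auto)
  then have "(\<integral>\<^sup>+ y\<in>ball c r. g y \<partial>M) / emeasure M (ball c r) * emeasure M (ball c r)
      \<le> umax M g x * emeasure M (ball c r)"
    by (rule mult_right_mono) simp
  then show ?thesis
    using ball_pos[OF r, of c] ball_finite[of c r]
    by (simp add: ennreal_divide_times)
qed

lemma umax_less_iff:
  "t < umax M g x \<longleftrightarrow> (\<exists>c r. x \<in> ball c r \<and> t * emeasure M (ball c r) < (\<integral>\<^sup>+ y\<in>ball c r. g y \<partial>M))"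
proof -
  have "t < I / m \<longleftrightarrow> t * m < I" if "0 < m" "m < top" for I m :: ennreal
    using that
    by (metis divide_less_ennreal ennreal_divide_self mult.commute not_less_iff_gr_or_eq order_less_irrefl
        ennreal_times_divide mult.right_neutral)
  moreover have "0 < r" if "x \<in> ball c r" for c r
    using that by (metis ball_eq_empty empty_iff not_le)
  ultimately show ?thesis
    unfolding umax_def less_SUP_iff using ball_pos ball_finite
    by (auto simp: infinity_ennreal_def) metis+
qed

lemma open_umax: "open {x. t < umax M g x}"
proof -
  have "{x. t < umax M g x} = (\<Union>(c, r)\<in>{(c, r). t * emeasure M (ball c r) < (\<integral>\<^sup>+ y\<in>ball c r. g y \<partial>M)}. ball c r)"
    unfolding umax_less_iff by blast
  then show ?thesis by (auto intro!: open_UN)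
qed

lemma borel_measurable_umax [measurable]: "umax M g \<in> borel_measurable M"
  by (rule borel_measurableI_greater) (use open_umax in \<open>auto simp: space_M intro!: open_sets_M\<close>)

text \<open>Vitali's lemma selects countably many disjoint balls whose fivefold dilates cover the
  union; doubling removes the dilation, and disjointness keeps the sum of the integrals below the
  full integral. The common bound \<open>R\<close> on the radii is what the covering lemma
  requires.\<close>

lemma umax_weak_bounded_radius:
  fixes I :: "('a \<times> real) set"
  assumes [measurable]: "g \<in> borel_measurable M"
    and I: "\<And>c r. (c, r) \<in> I \<Longrightarrow> 0 < r \<and> r \<le> R"
      "\<And>c r. (c, r) \<in> I \<Longrightarrow> t * emeasure M (ball c r) \<le> (\<integral>\<^sup>+ y\<in>ball c r. g y \<partial>M)"
  shows "t * emeasure M (\<Union>(c, r)\<in>I. ball c r) \<le> ennreal D * (\<integral>\<^sup>+ y. g y \<partial>M)"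
proof -
  let ?U = "\<Union>(c, r)\<in>I. ball c r"
  obtain C where C: "countable C" "C \<subseteq> I"
    "pairwise (\<lambda>i j. disjnt (ball (fst i) (snd i)) (ball (fst j) (snd j))) C"
    "?U \<subseteq> (\<Union>i\<in>C. ball (fst i) (5 * snd i))"
    by (rule Vitali_covering_lemma_balls[where S = ?U and K = I and a = fst and r = snd and B = R]) (use I(1) in auto)
  have U: "?U \<in> sets M" by (auto intro!: open_sets_M)
  have "emeasure M ?U = (\<integral>\<^sup>+ y. indicator ?U y \<partial>M)" using U by simp
  \<comment> \<open>Countable subadditivity in pointwise form, with sums over \<open>C\<close>
    written as integrals against the counting measure.\<close>
  also have "\<dots> \<le> (\<integral>\<^sup>+ y. (\<integral>\<^sup>+ i. indicator (ball (fst i) (5 * snd i)) y \<partial>count_space C) \<partial>M)"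
  proof (rule nn_integral_mono)
    fix y
    show "indicator ?U y \<le> (\<integral>\<^sup>+ i. indicator (ball (fst i) (5 * snd i)) y \<partial>count_space C)"
    proof (cases "y \<in> ?U")
      case True
      then obtain j where j: "j \<in> C" "y \<in> ball (fst j) (5 * snd j)" using C by blast
      then have "indicator ?U y = (\<integral>\<^sup>+ i. indicator {j} i \<partial>count_space C)"
        using True by (subst nn_integral_indicator) auto
      also have "\<dots> \<le> (\<integral>\<^sup>+ i. indicator (ball (fst i) (5 * snd i)) y \<partial>count_space C)"
        using j by (intro nn_integral_mono) (auto simp: indicator_def)
      finally show ?thesis .
    qed auto
  qed
  also have "\<dots> = (\<integral>\<^sup>+ i. emeasure M (ball (fst i) (5 * snd i)) \<partial>count_space C)"
    using C by (subst nn_integral_count_space_nn_integral) auto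
  also have "\<dots> \<le> (\<integral>\<^sup>+ i. ennreal D * emeasure M (ball (fst i) (snd i)) \<partial>count_space C)"
    using C I by (intro nn_integral_mono doubling) auto
  finally have "t * emeasure M ?U \<le> t * (\<integral>\<^sup>+ i. ennreal D * emeasure M (ball (fst i) (snd i)) \<partial>count_space C)"
    by (rule mult_left_mono) simp
  also have "\<dots> = (\<integral>\<^sup>+ i. ennreal D * (t * emeasure M (ball (fst i) (snd i))) \<partial>count_space C)"
    by (simp add: nn_integral_cmult[symmetric] mult_ac)
  also have "\<dots> \<le> (\<integral>\<^sup>+ i. ennreal D * (\<integral>\<^sup>+ y\<in>ball (fst i) (snd i). g y \<partial>M) \<partial>count_space C)"
    using C I(2) by (intro nn_integral_mono mult_left_mono) auto
  \<comment> \<open>Reading \<open>g\<close> as a density turns the sum of integrals into the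
    measure of a disjoint union.\<close>
  also have "\<dots> = ennreal D * (\<integral>\<^sup>+ i. emeasure (density M g) (ball (fst i) (snd i)) \<partial>count_space C)"
    by (simp add: nn_integral_cmult emeasure_density)
  also have "\<dots> = ennreal D * emeasure (density M g) (\<Union>i\<in>C. ball (fst i) (snd i))"
    using C by (subst emeasure_UN_countable)
      (auto simp: disjoint_family_on_def pairwise_def disjnt_def)
  also have "\<dots> \<le> ennreal D * (\<integral>\<^sup>+ y. g y \<partial>M)"
  proof (rule mult_left_mono)
    have "emeasure (density M g) (space M) = (\<integral>\<^sup>+ y. g y \<partial>M)"
      by (subst emeasure_density) (auto simp: space_M open_sets_M)
    then show "emeasure (density M g) (\<Union>i\<in>C. ball (fst i) (snd i)) \<le> (\<integral>\<^sup>+ y. g y \<partial>M)"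
      using emeasure_space[of "density M g" "\<Union>i\<in>C. ball (fst i) (snd i)"] by simp
  qed simp
  finally show ?thesis .
qed

text \<open>The superlevel set is exhausted by balls of radius at most \<open>n\<close>, to which
  the covering argument applies, and the bound passes to the increasing limit.\<close>

lemma umax_weak:
  assumes [measurable]: "g \<in> borel_measurable M"
  shows "t * emeasure M {x. t < umax M g x} \<le> ennreal D * (\<integral>\<^sup>+ y. g y \<partial>M)"
proof -
  define I where "I n = {(c, r). 0 < r \<and> r \<le> real n \<and> t * emeasure M (ball c r) < (\<integral>\<^sup>+ y\<in>ball c r. g y \<partial>M)}" for n
  define U where "U n = (\<Union>(c, r)\<in>I n. ball c r)" for n
  have "{x. t < umax M g x} = (\<Union>n. U n)"
  proof (intro set_eqI iffI)
    fix x assume "x \<in> {x. t < umax M g x}"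
    then obtain c r where cr: "x \<in> ball c r" "t * emeasure M (ball c r) < (\<integral>\<^sup>+ y\<in>ball c r. g y \<partial>M)"
      by (auto simp: umax_less_iff)
    obtain n where "r \<le> real n" using real_arch_simple by blast
    then have "(c, r) \<in> I n" using cr by (auto simp: I_def intro: le_less_trans[OF zero_le_dist])
    then have "x \<in> U n" unfolding U_def by (rule UN_I) (use cr in simp)
    then show "x \<in> (\<Union>n. U n)" by blast
  qed (auto simp: U_def I_def umax_less_iff)
  moreover have "incseq U"
    unfolding incseq_def U_def I_def by (intro allI impI UN_mono) auto
  moreover have "range U \<subseteq> sets M"
    by (auto simp: U_def intro!: open_sets_M)
  ultimately have "t * emeasure M {x. t < umax M g x} = (SUP n. t * emeasure M (U n))"
    by (simp add: SUP_emeasure_incseq[symmetric] SUP_mult_left_ennreal)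
  also have "\<dots> \<le> ennreal D * (\<integral>\<^sup>+ y. g y \<partial>M)"
    unfolding U_def by (intro SUP_least umax_weak_bounded_radius) (auto simp: I_def)
  finally show ?thesis .
qed

text \<open>Only the part of \<open>g\<close> above height \<open>t\<close> matters, because the part below contributes at
  most \<open>t\<close> to every average.\<close>

lemma umax_weak_truncated:
  assumes [measurable]: "g \<in> borel_measurable M" and t: "0 < t"
  shows "ennreal t * emeasure M {x. ennreal (2 * t) < umax M g x}
    \<le> ennreal D * (\<integral>\<^sup>+ y. g y * indicator {y. ennreal t < g y} y \<partial>M)"
proof -
  let ?h = "\<lambda>y. g y * indicator {y. ennreal t < g y} y"
  have [measurable]: "?h \<in> borel_measurable M" by measurable
  have "{x. ennreal (2 * t) < umax M g x} \<subseteq> {x. ennreal t < umax M ?h x}"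
  proof safe
    fix x assume "ennreal (2 * t) < umax M g x"
    then obtain c r where cr: "x \<in> ball c r"
      "ennreal (2 * t) * emeasure M (ball c r) < (\<integral>\<^sup>+ y\<in>ball c r. g y \<partial>M)"
      by (auto simp: umax_less_iff)
    let ?m = "emeasure M (ball c r)"
    have "ennreal t * ?m + ennreal t * ?m = ennreal (2 * t) * ?m"
      using t by (simp flip: distrib_right ennreal_plus)
    also have "\<dots> < (\<integral>\<^sup>+ y\<in>ball c r. g y \<partial>M)" by fact
    also have "\<dots> \<le> (\<integral>\<^sup>+ y. ?h y * indicator (ball c r) y + ennreal t * indicator (ball c r) y \<partial>M)"
      by (intro nn_integral_mono) (auto simp: indicator_def)
    also have "\<dots> = (\<integral>\<^sup>+ y\<in>ball c r. ?h y \<partial>M) + ennreal t * ?m"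
      by (subst nn_integral_add) (auto simp: nn_integral_cmult_indicator)
    finally have "ennreal t * ?m < (\<integral>\<^sup>+ y\<in>ball c r. ?h y \<partial>M)"
      by (meson add_right_mono not_le)
    then show "ennreal t < umax M ?h x"
      using cr umax_less_iff by blast
  qed
  then have "ennreal t * emeasure M {x. ennreal (2 * t) < umax M g x}
      \<le> ennreal t * emeasure M {x. ennreal t < umax M ?h x}"
    by (intro mult_left_mono emeasure_mono open_sets_M open_umax) auto
  also have "\<dots> \<le> ennreal D * (\<integral>\<^sup>+ y. ?h y \<partial>M)" by (rule umax_weak) measurable
  finally show ?thesis .
qed

text \<open>Marcinkiewicz interpolation: the layer-cake formula for \<open>umax M g\<close>, the
  truncated weak bound at half of each level, Fubini, and the layer-cake formula for
  \<open>2 * g\<close> with the positive exponent \<open>q - 1\<close>.\<close>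

lemma umax_strong:
  assumes [measurable]: "g \<in> borel_measurable M" and q: "1 < q" and D: "0 \<le> D"
  shows "(\<integral>\<^sup>+ x. umax M g x epowr q \<partial>M)
    \<le> ennreal (q * D * 2 powr q / (q - 1)) * (\<integral>\<^sup>+ x. g x epowr q \<partial>M)"
proof -
  interpret M: sigma_finite_measure M by (rule sigma_finite)
  interpret pair_sigma_finite lborel M ..
  \<comment> \<open>Joint measurability in level and point, for the two applications of
    Fubini.\<close>
  have [measurable]: "Measurable.pred (lborel \<Otimes>\<^sub>M M) (\<lambda>(l, x). 0 < l \<and> ennreal l < umax M g x)"
    "Measurable.pred (lborel \<Otimes>\<^sub>M M) (\<lambda>(l, x). 0 < l \<and> ennreal l < 2 * g x)"
    by measurable
  have "umax M g x epowr q = ennreal q *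
      (\<integral>\<^sup>+ l. ennreal (l powr (q - 1)) * indicator {l. 0 < l \<and> ennreal l < umax M g x} l \<partial>lborel)" for x
    using q by (subst nn_integral_powr_layer) (auto simp: mult.assoc[symmetric] simp flip: ennreal_mult)
  then have "(\<integral>\<^sup>+ x. umax M g x epowr q \<partial>M) = ennreal q * (\<integral>\<^sup>+ x.
      (\<integral>\<^sup>+ l. ennreal (l powr (q - 1)) * indicator {(l, x). 0 < l \<and> ennreal l < umax M g x} (l, x) \<partial>lborel) \<partial>M)"
    by (simp add: indicator_def nn_integral_cmult)
  also have "\<dots> = ennreal q * (\<integral>\<^sup>+ l.
      (\<integral>\<^sup>+ x. ennreal (l powr (q - 1)) * indicator {(l, x). 0 < l \<and> ennreal l < umax M g x} (l, x) \<partial>M) \<partial>lborel)"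
    by (subst Fubini') (auto simp: case_prod_beta')
  also have "\<dots> \<le> ennreal q * (\<integral>\<^sup>+ l. (\<integral>\<^sup>+ x. ennreal (2 * D) *
      (ennreal (l powr (q - 2)) * (g x * indicator {(l, x). 0 < l \<and> ennreal l < 2 * g x} (l, x))) \<partial>M) \<partial>lborel)"
  proof (rule mult_left_mono, rule nn_integral_mono)
    fix l :: real
    show "(\<integral>\<^sup>+ x. ennreal (l powr (q - 1)) * indicator {(l, x). 0 < l \<and> ennreal l < umax M g x} (l, x) \<partial>M)
      \<le> (\<integral>\<^sup>+ x. ennreal (2 * D) * (ennreal (l powr (q - 2)) * (g x * indicator {(l, x). 0 < l \<and> ennreal l < 2 * g x} (l, x))) \<partial>M)"
    proof (cases "0 < l")
      case True
      have half: "ennreal l < 2 * y \<longleftrightarrow> ennreal (l / 2) < y" for y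
        using True by (cases y) (auto simp: ennreal_less_iff ennreal_mult_top simp flip: ennreal_numeral ennreal_mult)
      have "(\<integral>\<^sup>+ x. ennreal (l powr (q - 1)) * indicator {(l, x). 0 < l \<and> ennreal l < umax M g x} (l, x) \<partial>M)
        = ennreal (l powr (q - 1)) * emeasure M {x. ennreal l < umax M g x}"
        using True open_umax[of "ennreal l" g]
        by (simp add: nn_integral_cmult_indicator[symmetric] open_sets_M indicator_def)
      \<comment> \<open>The level is written \<open>2 * (l / 2)\<close> to fit the truncated bound,
        and the factor \<open>l / 2\<close> is taken out of \<open>l powr (q - 1)\<close>.\<close>
      also have "\<dots> = ennreal (2 * l powr (q - 2)) * (ennreal (l / 2) * emeasure M {x. ennreal (2 * (l / 2)) < umax M g x})"
        using True powr_add[of l "q - 2" 1] by (simp add: mult.assoc[symmetric] flip: ennreal_mult)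
      also have "\<dots> \<le> ennreal (2 * l powr (q - 2)) * (ennreal D * (\<integral>\<^sup>+ y. g y * indicator {y. ennreal (l / 2) < g y} y \<partial>M))"
        using True by (intro mult_left_mono umax_weak_truncated) auto
      also have "\<dots> = (\<integral>\<^sup>+ x. ennreal (2 * D) * (ennreal (l powr (q - 2)) * (g x * indicator {(l, x). 0 < l \<and> ennreal l < 2 * g x} (l, x))) \<partial>M)"
      proof -
        have "indicator {(l, x). 0 < l \<and> ennreal l < 2 * g x} (l, x) = (indicator {y. ennreal (l / 2) < g y} x :: ennreal)" for x
          using True by (simp add: half indicator_def)
        then have "(\<integral>\<^sup>+ x. ennreal (2 * D) * (ennreal (l powr (q - 2)) * (g x * indicator {(l, x). 0 < l \<and> ennreal l < 2 * g x} (l, x))) \<partial>M)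
          = ennreal (2 * D) * (ennreal (l powr (q - 2)) * (\<integral>\<^sup>+ y. g y * indicator {y. ennreal (l / 2) < g y} y \<partial>M))"
          by (simp add: nn_integral_cmult)
        then show ?thesis
          using D by (simp add: ennreal_mult mult_ac)
      qed
      finally show ?thesis .
    qed simp
  qed simp
  also have "\<dots> = ennreal q * (\<integral>\<^sup>+ x. (\<integral>\<^sup>+ l. ennreal (2 * D) *
      (ennreal (l powr (q - 2)) * (g x * indicator {(l, x). 0 < l \<and> ennreal l < 2 * g x} (l, x))) \<partial>lborel) \<partial>M)"
    by (subst Fubini') (auto simp: case_prod_beta')
  \<comment> \<open>The exponent \<open>q - 2\<close> becomes \<open>q - 1 - 1\<close> to match the
    layer-cake formula with \<open>s = q - 1\<close>.\<close>
  also have "\<dots> = ennreal q * (\<integral>\<^sup>+ x. ennreal (2 * D) * (g x *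
     (\<integral>\<^sup>+ l. ennreal (l powr (q - 1 - 1)) * indicator {l. 0 < l \<and> ennreal l < 2 * g x} l \<partial>lborel)) \<partial>M)"
    by (simp add: nn_integral_cmult[symmetric] indicator_def mult_ac)
  also have "\<dots> = ennreal q * (\<integral>\<^sup>+ x. ennreal (D * 2 powr q / (q - 1)) * g x epowr q \<partial>M)"
  proof -
    \<comment> \<open>One factor 2 stems from the weak bound at half level, and
      \<open>2 powr (q - 1)\<close> from the power of \<open>2 * y\<close>.\<close>
    have "ennreal (2 * D) * (y * (ennreal (1 / (q - 1)) * (2 * y) epowr (q - 1)))
        = ennreal (D * 2 powr q / (q - 1)) * y epowr q" for y
    proof -
      have "(2 * y) epowr (q - 1) = ennreal (2 powr (q - 1)) * y epowr (q - 1)"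
        using q epowr_ennreal[of 2 "q - 1"] by (simp add: epowr_mult)
      moreover have "y * y epowr (q - 1) = y epowr q"
        using q epowr_add[of 1 "q - 1" y] by simp
      moreover have "2 powr (q - 1) = 2 powr q / 2" by (simp add: powr_diff)
      ultimately have "ennreal (2 * D) * (y * (ennreal (1 / (q - 1)) * (2 * y) epowr (q - 1)))
          = ennreal (2 * D) * ennreal (1 / (q - 1)) * ennreal (2 powr q / 2) * y epowr q"
        by (metis mult.assoc mult.left_commute)
      moreover have "2 * D * (1 / (q - 1)) * (2 powr q / 2) = D * 2 powr q / (q - 1)"
        using q by (simp add: field_simps)
      ultimately show ?thesis
        using q D by (metis ennreal_mult' diff_ge_0_iff_ge less_imp_le zero_le_divide_1_iff zero_le_mult_iff zero_le_numeral)
    qed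
    moreover have "0 < q - 1" using q by simp
    ultimately show ?thesis by (simp only: nn_integral_powr_layer)
  qed
  also have "\<dots> = ennreal (q * D * 2 powr q / (q - 1)) * (\<integral>\<^sup>+ x. g x epowr q \<partial>M)"
    using q D by (simp add: nn_integral_cmult mult.assoc[symmetric] flip: ennreal_mult)
  finally show ?thesis .
qed

end

subsection \<open>Weights with an averaging inequality\<close>

text \<open>Counterpart of \<open>maxfun\<close> for extended nonnegative functions;
  \<open>maxfun f\<close> is \<open>hl_max\<close> of |f|.\<close>

definition hl_max :: "('a::euclidean_space \<Rightarrow> ennreal) \<Rightarrow> 'a \<Rightarrow> ennreal" where
  "hl_max F x = (SUP r\<in>{0<..}. (\<integral>\<^sup>+ y\<in>ball x r. F y \<partial>lebesgue) / emeasure lebesgue (ball x r))"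

section \<open>Lebesgue measure of balls and centred averages\<close>

lemma ball_sets_lebesgue [measurable, simp]: "ball (c::'a::euclidean_space) r \<in> sets lebesgue"
  by (simp add: borel_open)

lemma emeasure_ball_pos: "0 < r \<Longrightarrow> 0 < emeasure lebesgue (ball (c::'a::euclidean_space) r)"
  using content_ball_pos[of r c] by (auto simp: measure_def enn2real_positive_iff zero_less_iff_neq_zero)

lemma emeasure_ball_finite: "emeasure lebesgue (ball (c::'a::euclidean_space) r) < top"
  using lmeasurable_ball[of c r] unfolding fmeasurable_def by simp

lemma emeasure_ball_scale:
  fixes c d :: "'a::euclidean_space"
  assumes "0 \<le> k" "0 \<le> r"
  shows "emeasure lebesgue (ball c (k * r)) = ennreal (k ^ DIM('a)) * emeasure lebesgue (ball d r)"
  using assms emeasure_lebesgue_ball_conv_unit_ball[of "k * r" c] emeasure_lebesgue_ball_conv_unit_ball[of r d]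
  by (simp add: power_mult_distrib ennreal_mult mult.assoc)

lemma hl_max_le:
  assumes "\<And>r. 0 < r \<Longrightarrow> (\<integral>\<^sup>+ y\<in>ball x r. F y \<partial>lebesgue) \<le> emeasure lebesgue (ball x r) * t"
  shows "hl_max F x \<le> t"
  unfolding hl_max_def
  using assms by (intro SUP_least divide_le_posI_ennreal emeasure_ball_pos) auto

lemma average_le_hl_max:
  assumes "0 < r"
  shows "(\<integral>\<^sup>+ y\<in>ball x r. F y \<partial>lebesgue) \<le> emeasure lebesgue (ball x r) * hl_max F x"
proof -
  have "(\<integral>\<^sup>+ y\<in>ball x r. F y \<partial>lebesgue) / emeasure lebesgue (ball x r) \<le> hl_max F x"
    unfolding hl_max_def using assms by (intro SUP_upper) auto
  then have "emeasure lebesgue (ball x r) * ((\<integral>\<^sup>+ y\<in>ball x r. F y \<partial>lebesgue) / emeasure lebesgue (ball x r))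
      \<le> emeasure lebesgue (ball x r) * hl_max F x"
    by (rule mult_left_mono) simp
  then show ?thesis
    using emeasure_ball_pos[OF assms, of x] emeasure_ball_finite[of x r]
    by (simp add: ennreal_times_divide mult.commute[of "emeasure _ _"] mult_divide_eq_ennreal)
qed

text \<open>The property shared by all classes A_p: the average of \<open>F\<close> over a ball is
  at most \<open>K\<close> times its weighted L^p mean there. Denominators are multiplied out, and
  \<open>u\<close> is extended-valued so that dual weights are covered.\<close>

locale averaging_weight =
  fixes u :: "'a::euclidean_space \<Rightarrow> ennreal" and p K :: real
  assumes u_measurable [measurable]: "u \<in> borel_measurable lebesgue"
    and p_ge_1: "1 \<le> p" and K_pos: "0 < K"
    and weight_pos: "0 < r \<Longrightarrow> 0 < emeasure (density lebesgue u) (ball c r)"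
    and weight_finite: "emeasure (density lebesgue u) (ball c r) < top"
    and averaging: "0 < r \<Longrightarrow> F \<in> borel_measurable lebesgue \<Longrightarrow>
      emeasure (density lebesgue u) (ball c r) epowr (1 / p) * (\<integral>\<^sup>+ x\<in>ball c r. F x \<partial>lebesgue)
      \<le> ennreal K * emeasure lebesgue (ball c r) * (\<integral>\<^sup>+ x\<in>ball c r. F x epowr p * u x \<partial>lebesgue) epowr (1 / p)"
begin

abbreviation "\<mu> \<equiv> density lebesgue u"

text \<open>Testing the averaging inequality on the indicator of the smaller ball.\<close>

lemma doubling: "0 < r \<Longrightarrow> emeasure \<mu> (ball c (5 * r)) \<le> ennreal ((K * 5 ^ DIM('a)) powr p) * emeasure \<mu> (ball c r)"
proof -
  assume r: "0 < r"
  let ?L = "emeasure lebesgue (ball c r)"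
  have "emeasure \<mu> (ball c (5 * r)) epowr (1 / p) * (\<integral>\<^sup>+ x\<in>ball c (5 * r). indicator (ball c r) x \<partial>lebesgue)
      \<le> ennreal K * emeasure lebesgue (ball c (5 * r))
        * (\<integral>\<^sup>+ x\<in>ball c (5 * r). indicator (ball c r) x epowr p * u x \<partial>lebesgue) epowr (1 / p)"
    using r by (intro averaging) auto
  also have "(\<integral>\<^sup>+ x\<in>ball c (5 * r). indicator (ball c r) x \<partial>lebesgue) = (\<integral>\<^sup>+ x. indicator (ball c r) x \<partial>lebesgue)"
    using r by (intro nn_integral_cong) (auto simp: indicator_def)
  also have "\<dots> = ?L" by simp
  also have "(\<integral>\<^sup>+ x\<in>ball c (5 * r). indicator (ball c r) x epowr p * u x \<partial>lebesgue) = emeasure \<mu> (ball c r)"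
    using r p_ge_1 by (subst emeasure_density) (auto intro!: nn_integral_cong simp: indicator_def)
  also have "emeasure lebesgue (ball c (5 * r)) = ennreal (5 ^ DIM('a)) * ?L"
    using r by (intro emeasure_ball_scale) auto
  finally have "?L * (emeasure \<mu> (ball c (5 * r)) epowr (1 / p))
      \<le> ?L * (ennreal (K * 5 ^ DIM('a)) * emeasure \<mu> (ball c r) epowr (1 / p))"
    using K_pos by (simp add: ennreal_mult mult_ac)
  then have "emeasure \<mu> (ball c (5 * r)) epowr (1 / p) \<le> ennreal (K * 5 ^ DIM('a)) * emeasure \<mu> (ball c r) epowr (1 / p)"
    using emeasure_ball_pos[OF r, of c] emeasure_ball_finite[of c r]
    by (subst (asm) ennreal_mult_le_mult_iff) auto
  then have "(emeasure \<mu> (ball c (5 * r)) epowr (1 / p)) epowr p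
      \<le> (ennreal (K * 5 ^ DIM('a)) * emeasure \<mu> (ball c r) epowr (1 / p)) epowr p"
    using p_ge_1 by (intro epowr_mono) auto
  then show ?thesis
    using p_ge_1 K_pos by (simp add: epowr_mult root_epowr epowr_ennreal)
qed

sublocale doubling_measure \<mu> "(K * 5 ^ DIM('a)) powr p"
  by standard (use weight_pos weight_finite doubling in \<open>auto simp: infinity_ennreal_def\<close>)

text \<open>For \<open>F\<close> = |f| this is the supremum on the right of the final theorem, with
  the weighted norm unfolded.\<close>

definition sup_average :: "('a \<Rightarrow> ennreal) \<Rightarrow> 'a \<Rightarrow> real \<Rightarrow> ennreal" where
  "sup_average F a r = (SUP t\<in>{r<..}. emeasure \<mu> (ball a t) epowr (- 1 / p)
     * (\<integral>\<^sup>+ x\<in>ball a t. F x epowr p * u x \<partial>lebesgue) epowr (1 / p))"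

text \<open>One term of the supremum, multiplied by its weight factor, which is invertible because
  balls have positive finite measure.\<close>

lemma norm_le_sup_average:
  assumes "0 < r" "r < t"
  shows "(\<integral>\<^sup>+ x\<in>ball a t. F x epowr p * u x \<partial>lebesgue) epowr (1 / p)
    \<le> emeasure \<mu> (ball a t) epowr (1 / p) * sup_average F a r" (is "?N \<le> ?W * _")
proof -
  have W: "?W \<noteq> 0" "?W \<noteq> top"
    using weight_pos[of t a] weight_finite[of a t] assms p_ge_1
    by (auto simp: epowr_eq_0_iff epowr_eq_top_iff)
  have "emeasure \<mu> (ball a t) epowr (- 1 / p) = inverse ?W"
    using epowr_minus[of "1 / p"] p_ge_1 by simp
  then have "inverse ?W * ?N \<le> sup_average F a r"
    unfolding sup_average_def using assms by (intro SUP_upper2[of t]) auto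
  then have "?W * (inverse ?W * ?N) \<le> ?W * sup_average F a r"
    by (rule mult_left_mono) simp
  moreover have "?W * inverse ?W = 1"
    using W by (metis divide_ennreal_def ennreal_divide_self less_top)
  ultimately show ?thesis by (simp add: mult.assoc[symmetric])
qed

text \<open>The averaging inequality on \<open>ball a t\<close> carries the same factor
  \<open>?W\<close> as the norm bound, and it cancels.\<close>

lemma average_le_sup_average:
  assumes [measurable]: "F \<in> borel_measurable lebesgue" and rt: "0 < r" "r < t"
  shows "(\<integral>\<^sup>+ x\<in>ball a t. F x \<partial>lebesgue) \<le> ennreal K * emeasure lebesgue (ball a t) * sup_average F a r"
proof -
  let ?W = "emeasure \<mu> (ball a t) epowr (1 / p)"
  have W: "?W \<noteq> 0" "?W \<noteq> top"
    using weight_pos[of t a] weight_finite[of a t] rt p_ge_1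
    by (auto simp: epowr_eq_0_iff epowr_eq_top_iff)
  have "?W * (\<integral>\<^sup>+ x\<in>ball a t. F x \<partial>lebesgue)
      \<le> ennreal K * emeasure lebesgue (ball a t) * (\<integral>\<^sup>+ x\<in>ball a t. F x epowr p * u x \<partial>lebesgue) epowr (1 / p)"
    using rt by (intro averaging) auto
  also have "\<dots> \<le> ennreal K * emeasure lebesgue (ball a t) * (?W * sup_average F a r)"
    by (intro mult_left_mono norm_le_sup_average rt) auto
  finally show ?thesis
    using W by (subst (asm) mult.left_commute, subst (asm) ennreal_mult_le_mult_iff) auto
qed

text \<open>The part of \<open>F\<close> far from \<open>ball a r\<close> is only seen by averages over large balls, and these are
  comparable with averages over balls centred at \<open>a\<close>.\<close>

lemma hl_max_local:
  assumes [measurable]: "F \<in> borel_measurable lebesgue" and x: "x \<in> ball a r"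
  shows "hl_max F x \<le> max (hl_max (\<lambda>y. F y * indicator (ball a (5 * r)) y) x)
    (ennreal (K * 5 ^ DIM('a)) * sup_average F a r)" (is "_ \<le> max ?M ?S")
proof (rule hl_max_le)
  have r: "0 < r" using x by (metis ball_eq_empty empty_iff not_le)
  fix s :: real assume s: "0 < s"
  show "(\<integral>\<^sup>+ y\<in>ball x s. F y \<partial>lebesgue) \<le> emeasure lebesgue (ball x s) * max ?M ?S"
  \<comment> \<open>As \<open>dist a x < r\<close>, a ball of radius \<open>s \<le> 4 * r\<close>
    about \<open>x\<close> stays in \<open>ball a (5 * r)\<close>, while for larger \<open>s\<close>
    it lies in \<open>ball a (5 * s)\<close>, whose radius exceeds \<open>r\<close>.\<close>
  proof (cases "s \<le> 4 * r")
    case True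
    have "dist a y < 5 * r" if "dist x y < s" for y
      using x that True dist_triangle[of a y x] by simp
    then have "(\<integral>\<^sup>+ y\<in>ball x s. F y \<partial>lebesgue) = (\<integral>\<^sup>+ y\<in>ball x s. F y * indicator (ball a (5 * r)) y \<partial>lebesgue)"
      by (intro nn_integral_cong) (auto simp: indicator_def)
    also have "\<dots> \<le> emeasure lebesgue (ball x s) * ?M"
      by (rule average_le_hl_max[OF s])
    also have "\<dots> \<le> emeasure lebesgue (ball x s) * max ?M ?S"
      by (intro mult_left_mono) auto
    finally show ?thesis .
  next
    case False
    have "dist a y < 5 * s" if "dist x y < s" for y
      using x that False r dist_triangle[of a y x] by simp
    then have "(\<integral>\<^sup>+ y\<in>ball x s. F y \<partial>lebesgue) \<le> (\<integral>\<^sup>+ y\<in>ball a (5 * s). F y \<partial>lebesgue)"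
      by (intro nn_integral_mono) (auto simp: indicator_def)
    also have "\<dots> \<le> ennreal K * emeasure lebesgue (ball a (5 * s)) * sup_average F a r"
      using r False by (intro average_le_sup_average) auto
    also have "\<dots> = emeasure lebesgue (ball x s) * ?S"
      using emeasure_ball_scale[of 5 s a x] s K_pos by (simp add: ennreal_mult mult_ac)
    also have "\<dots> \<le> emeasure lebesgue (ball x s) * max ?M ?S"
      by (intro mult_left_mono) auto
    finally show ?thesis .
  qed
qed

end

subsection \<open>Muckenhoupt's theorem\<close>

text \<open>\<open>AE_dual\<close> says v = u^(-1/(p-1)) almost everywhere, and \<open>Ap\<close> is
  the \<open>p\<close>-th root of the A_p condition. Both are written symmetrically in (u, p) and
  (v, q) so that the roles can be exchanged.\<close>

locale dual_weights =
  fixes u v :: "'a::euclidean_space \<Rightarrow> ennreal" and p q K :: real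
  assumes meas [measurable]: "u \<in> borel_measurable lebesgue" "v \<in> borel_measurable lebesgue"
    and exponents: "1 < p" "1 < q" "1 / p + 1 / q = 1" and K_gt_0: "0 < K"
    and AE_dual: "AE x in lebesgue. u x \<noteq> top \<and> v x \<noteq> top \<and> u x epowr (1 / p) * v x epowr (1 / q) = 1"
    and pos: "0 < r \<Longrightarrow> 0 < emeasure (density lebesgue u) (ball c r)"
      "0 < r \<Longrightarrow> 0 < emeasure (density lebesgue v) (ball c r)"
    and fin: "emeasure (density lebesgue u) (ball c r) < top"
      "emeasure (density lebesgue v) (ball c r) < top"
    and Ap: "0 < r \<Longrightarrow> emeasure (density lebesgue u) (ball c r) epowr (1 / p)
      * emeasure (density lebesgue v) (ball c r) epowr (1 / q) \<le> ennreal K * emeasure lebesgue (ball c r)"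
begin

text \<open>The duality between A_p and A_q: every result about \<open>u\<close> and
  \<open>p\<close> becomes one about \<open>v\<close> and \<open>q\<close>.\<close>

lemma swap: "dual_weights v u q p K"
proof
  show "AE x in lebesgue. v x \<noteq> top \<and> u x \<noteq> top \<and> v x epowr (1 / q) * u x epowr (1 / p) = 1"
    using AE_dual by (auto simp: mult.commute)
qed (use exponents K_gt_0 pos fin Ap in \<open>auto simp: mult.commute add.commute\<close>)

text \<open>Almost everywhere \<open>F\<close> is the product of F u^(1/p) and v^(1/q); Hoelder's
  inequality separates them, and \<open>Ap\<close> absorbs the dual factor
  \<open>?V\<close>.\<close>

lemma averaging_u: "averaging_weight u p K"
proof
  fix r :: real and c :: 'a and F :: "'a \<Rightarrow> ennreal"
  assume r: "0 < r" and [measurable]: "F \<in> borel_measurable lebesgue"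
  let ?B = "ball c r"
  let ?U = "emeasure (density lebesgue u) ?B" and ?V = "emeasure (density lebesgue v) ?B"
  have pq: "0 < p" "0 < q" using exponents by auto
  have "(\<integral>\<^sup>+ x\<in>?B. F x \<partial>lebesgue)
      = (\<integral>\<^sup>+ x. (F x * indicator ?B x * u x epowr (1 / p)) * (v x epowr (1 / q) * indicator ?B x) \<partial>lebesgue)"
  proof (rule nn_integral_cong_AE)
    show "AE x in lebesgue. F x * indicator ?B x
        = (F x * indicator ?B x * u x epowr (1 / p)) * (v x epowr (1 / q) * indicator ?B x)"
      using AE_dual by eventually_elim (auto simp: indicator_def mult.assoc)
  qed
  also have "\<dots> \<le> (\<integral>\<^sup>+ x. (F x * indicator ?B x * u x epowr (1 / p)) epowr p \<partial>lebesgue) epowr (1 / p)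
      * (\<integral>\<^sup>+ x. (v x epowr (1 / q) * indicator ?B x) epowr q \<partial>lebesgue) epowr (1 / q)"
    using exponents by (intro nn_integral_Holder) auto
  also have "(\<integral>\<^sup>+ x. (F x * indicator ?B x * u x epowr (1 / p)) epowr p \<partial>lebesgue)
      = (\<integral>\<^sup>+ x\<in>?B. F x epowr p * u x \<partial>lebesgue)"
    using pq by (intro nn_integral_cong) (auto simp: epowr_mult root_epowr indicator_def)
  also have "(\<integral>\<^sup>+ x. (v x epowr (1 / q) * indicator ?B x) epowr q \<partial>lebesgue) = ?V"
    using pq by (subst emeasure_density) (auto intro!: nn_integral_cong simp: epowr_mult root_epowr indicator_def)
  finally have "?U epowr (1 / p) * (\<integral>\<^sup>+ x\<in>?B. F x \<partial>lebesgue)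
      \<le> ?U epowr (1 / p) * ((\<integral>\<^sup>+ x\<in>?B. F x epowr p * u x \<partial>lebesgue) epowr (1 / p) * ?V epowr (1 / q))"
    by (rule mult_left_mono) simp
  also have "\<dots> = (?U epowr (1 / p) * ?V epowr (1 / q)) * (\<integral>\<^sup>+ x\<in>?B. F x epowr p * u x \<partial>lebesgue) epowr (1 / p)"
    by (simp add: mult_ac)
  also have "\<dots> \<le> (ennreal K * emeasure lebesgue ?B) * (\<integral>\<^sup>+ x\<in>?B. F x epowr p * u x \<partial>lebesgue) epowr (1 / p)"
    by (intro mult_right_mono Ap r) auto
  finally show "?U epowr (1 / p) * (\<integral>\<^sup>+ x\<in>?B. F x \<partial>lebesgue)
    \<le> ennreal K * emeasure lebesgue ?B * (\<integral>\<^sup>+ x\<in>?B. F x epowr p * u x \<partial>lebesgue) epowr (1 / p)" .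
qed (use exponents K_gt_0 pos fin in auto)

text \<open>The \<open>q\<close>-th power of the duality relation gives u^(q-1) v = 1, so u^(1-q) =
  v. The quantifier over \<open>m\<close> stands inside so that one null set serves values that vary
  with \<open>x\<close>.\<close>

lemma AE_quotient_power: "AE x in lebesgue. \<forall>m. (m / u x) epowr q * u x = m epowr q * v x"
  using AE_dual
proof eventually_elim
  fix x assume x: "u x \<noteq> top \<and> v x \<noteq> top \<and> u x epowr (1 / p) * v x epowr (1 / q) = 1"
  have pq: "0 < p" "0 < q" "q / p = q - 1"
    using exponents by (auto simp: field_simps)
  obtain s t where st: "0 \<le> s" "u x = ennreal s" "0 \<le> t" "v x = ennreal t"
    using x by (metis ennreal_cases)
  have eq: "s powr (1 / p) * t powr (1 / q) = 1"
    using x st pq by (simp add: epowr_ennreal_pos ennreal_eq_1 flip: ennreal_mult)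
  then have s: "0 < s" using st(1) by (cases "s = 0") auto
  have "(s powr (1 / p) * t powr (1 / q)) powr q = s powr (q - 1) * t"
    using s st pq by (simp add: powr_mult powr_powr)
  then have "s powr (q - 1) * t = 1" using eq by simp
  then have t: "t = (1 / s) powr q * s"
    using s by (simp add: powr_diff powr_divide field_simps)
  show "\<forall>m. (m / u x) epowr q * u x = m epowr q * v x"
  proof
    fix m :: ennreal
    have "m / u x = m * ennreal (1 / s)"
      using s st by (simp add: divide_ennreal_def inverse_ennreal inverse_eq_divide)
    then show "(m / u x) epowr q * u x = m epowr q * v x"
      using s st pq by (simp add: epowr_mult epowr_ennreal mult.assoc t flip: ennreal_mult)
  qed
qed

lemma AE_mult_quotient: "AE x in lebesgue. \<forall>m. m / u x * u x = m"
  using AE_dual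
proof eventually_elim
  fix x assume x: "u x \<noteq> top \<and> v x \<noteq> top \<and> u x epowr (1 / p) * v x epowr (1 / q) = 1"
  then have "u x \<noteq> 0" using exponents by auto
  then show "\<forall>m. m / u x * u x = m" using x
    by (simp add: divide_ennreal_def mult.assoc mult.commute[of "inverse _"])
      (metis divide_ennreal_def ennreal_divide_self less_top mult.right_neutral)
qed

text \<open>Lerner's pointwise bound: the average over a ball centred at \<open>x\<close> is an average of
  \<open>F / v\<close> against \<open>v\<close>, hence below \<open>umax\<close> of \<open>F / v\<close> at every point of the ball.\<close>

lemma hl_max_le_umax:
  assumes [measurable]: "F \<in> borel_measurable lebesgue"
  defines "G \<equiv> \<lambda>y. umax (density lebesgue v) (\<lambda>z. F z / v z) y epowr (p - 1) / u y"
  shows "hl_max F x \<le> (ennreal (K powr p) * umax (density lebesgue u) G x) epowr (1 / (p - 1))"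
proof (rule hl_max_le)
  fix r :: real assume r: "0 < r"
  interpret dual: dual_weights v u q p K by (rule swap)
  interpret U: averaging_weight u p K by (rule averaging_u)
  interpret V: averaging_weight v q K by (rule dual.averaging_u)
  let ?B = "ball x r"
  let ?A = "\<integral>\<^sup>+ y\<in>?B. F y \<partial>lebesgue"
  let ?L = "emeasure lebesgue ?B" and ?U = "emeasure U.\<mu> ?B" and ?V = "emeasure V.\<mu> ?B"
  let ?T = "umax U.\<mu> G x"
  let ?Mv = "umax V.\<mu> (\<lambda>z. F z / v z)"
  have [measurable]: "?Mv \<in> borel_measurable lebesgue"
    using V.borel_measurable_umax by (simp add: measurable_def)
  have [measurable]: "G \<in> borel_measurable lebesgue"
    unfolding G_def by measurable
  have p1: "0 < p - 1" "0 < p" "0 < q" "p / q = p - 1"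
    using exponents by (auto simp: field_simps)
  have A: "?A = (\<integral>\<^sup>+ y\<in>?B. F y / v y \<partial>V.\<mu>)"
  proof -
    have "?A = (\<integral>\<^sup>+ y. v y * (F y / v y * indicator ?B y) \<partial>lebesgue)"
    proof (rule nn_integral_cong_AE)
      show "AE y in lebesgue. F y * indicator ?B y = v y * (F y / v y * indicator ?B y)"
        using dual.AE_mult_quotient by eventually_elim (auto simp: mult_ac indicator_def)
    qed
    then show ?thesis by (subst nn_integral_density) auto
  qed
  \<comment> \<open>The power of the average is integrated as a constant, so that at each
    \<open>y\<close> in the ball it can be compared with \<open>?Mv y\<close>.\<close>
  have "?A epowr (p - 1) * ?L = (\<integral>\<^sup>+ y\<in>?B. ?A epowr (p - 1) \<partial>lebesgue)"
    by (simp add: nn_integral_cmult_indicator)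
  also have "\<dots> \<le> (\<integral>\<^sup>+ y. ?V epowr (p - 1) * (?Mv y epowr (p - 1) * indicator ?B y) \<partial>lebesgue)"
  proof (rule nn_integral_mono)
    fix y
    show "?A epowr (p - 1) * indicator ?B y \<le> ?V epowr (p - 1) * (?Mv y epowr (p - 1) * indicator ?B y)"
    proof (cases "y \<in> ?B")
      case True
      then have "?A epowr (p - 1) \<le> (?Mv y * ?V) epowr (p - 1)"
        unfolding A by (intro epowr_mono p1 V.average_le_umax)
      then show ?thesis using True p1 by (simp add: epowr_mult mult.commute)
    qed simp
  qed
  also have "\<dots> = ?V epowr (p - 1) * (\<integral>\<^sup>+ y. ?Mv y epowr (p - 1) * indicator ?B y \<partial>lebesgue)"
    by (rule nn_integral_cmult) measurable
  \<comment> \<open>The division by \<open>u\<close> in \<open>G\<close> is compensated by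
    integrating against \<open>u\<close>, so that the maximal function of the second measure
    applies.\<close>
  also have "(\<integral>\<^sup>+ y. ?Mv y epowr (p - 1) * indicator ?B y \<partial>lebesgue) = (\<integral>\<^sup>+ y. u y * (G y * indicator ?B y) \<partial>lebesgue)"
  proof (rule nn_integral_cong_AE)
    show "AE y in lebesgue. ?Mv y epowr (p - 1) * indicator ?B y = u y * (G y * indicator ?B y)"
      unfolding G_def using AE_mult_quotient by eventually_elim (auto simp: mult_ac indicator_def)
  qed
  also have "\<dots> = (\<integral>\<^sup>+ y\<in>?B. G y \<partial>U.\<mu>)"
    by (subst nn_integral_density) auto
  also have "\<dots> \<le> ?T * ?U"
    using r by (intro U.average_le_umax) auto
  finally have "?A epowr (p - 1) * ?L \<le> ?V epowr (p - 1) * (?T * ?U)"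
    by (simp add: mult_left_mono)
  also have "\<dots> = ?T * (?U * ?V epowr (p - 1))" by (simp add: mult_ac)
  \<comment> \<open>Since \<open>p / q = p - 1\<close>, this is the \<open>p\<close>-th power of the
    left-hand side of \<open>Ap\<close>.\<close>
  also have "?U * ?V epowr (p - 1) = (?U epowr (1 / p) * ?V epowr (1 / q)) epowr p"
    using p1 by (simp add: epowr_mult epowr_epowr)
  also have "?T * \<dots> \<le> ?T * (ennreal K * ?L) epowr p"
    using p1 by (intro mult_left_mono epowr_mono Ap r) auto
  also have "(ennreal K * ?L) epowr p = ennreal (K powr p) * (?L epowr (p - 1) * ?L)"
    using p1 K_gt_0 epowr_add[of "p - 1" 1 ?L] by (simp add: epowr_mult epowr_ennreal)
  finally have "?L * ?A epowr (p - 1) \<le> ?L * (?L epowr (p - 1) * (ennreal (K powr p) * ?T))"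
    by (simp add: mult_ac)
  then have "?A epowr (p - 1) \<le> ?L epowr (p - 1) * (ennreal (K powr p) * ?T)"
    using emeasure_ball_pos[OF r, of x] emeasure_ball_finite[of x r]
    by (subst (asm) ennreal_mult_le_mult_iff) auto
  then have "(?A epowr (p - 1)) epowr (1 / (p - 1)) \<le> (?L epowr (p - 1) * (ennreal (K powr p) * ?T)) epowr (1 / (p - 1))"
    using p1 by (intro epowr_mono) auto
  then show "?A \<le> ?L * (ennreal (K powr p) * ?T) epowr (1 / (p - 1))"
    using p1 by (simp add: epowr_mult[of "1 / (p - 1)"] epowr_root)
qed

text \<open>The majorant \<open>H\<close> makes it unnecessary to prove that \<open>hl_max F\<close> is measurable.\<close>

theorem hl_max_strong:
  "\<exists>C>0. \<forall>F\<in>borel_measurable lebesgue. \<exists>H\<in>borel_measurable lebesgue.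
     (\<forall>x. hl_max F x \<le> H x) \<and>
     (\<integral>\<^sup>+ x. H x epowr p * u x \<partial>lebesgue) \<le> ennreal C * (\<integral>\<^sup>+ x. F x epowr p * u x \<partial>lebesgue)"
proof -
  interpret dual: dual_weights v u q p K by (rule swap)
  interpret U: averaging_weight u p K by (rule averaging_u)
  interpret V: averaging_weight v q K by (rule dual.averaging_u)
  have p1: "0 < p - 1" "0 < p" "0 < q" "1 / (p - 1) * p = q" "(p - 1) * q = p"
    using exponents by (auto simp: field_simps)
  \<comment> \<open>The \<open>p\<close>-th power of \<open>H\<close> is a \<open>q\<close>-th power
    of the maximal function of \<open>G\<close>, and the \<open>q\<close>-th power of
    \<open>G\<close> involves a \<open>p\<close>-th power of the maximal function for
    \<open>v\<close>; hence exponent \<open>q\<close> with \<open>u\<close> and \<open>p\<close>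
    with \<open>v\<close>.\<close>
  obtain Cu where Cu: "0 < Cu" "\<And>g. g \<in> borel_measurable U.\<mu> \<Longrightarrow>
      (\<integral>\<^sup>+ x. umax U.\<mu> g x epowr q \<partial>U.\<mu>) \<le> ennreal Cu * (\<integral>\<^sup>+ x. g x epowr q \<partial>U.\<mu>)"
    using U.umax_strong[of _ q] exponents K_gt_0
    by (intro that[of "q * (K * 5 ^ DIM('a)) powr p * 2 powr q / (q - 1)"]) auto
  obtain Cv where Cv: "0 < Cv" "\<And>g. g \<in> borel_measurable V.\<mu> \<Longrightarrow>
      (\<integral>\<^sup>+ x. umax V.\<mu> g x epowr p \<partial>V.\<mu>) \<le> ennreal Cv * (\<integral>\<^sup>+ x. g x epowr p \<partial>V.\<mu>)"
    using V.umax_strong[of _ p] exponents K_gt_0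
    by (intro that[of "p * (K * 5 ^ DIM('a)) powr q * 2 powr p / (p - 1)"]) auto
  show ?thesis
  proof (intro exI[of _ "(K powr p) powr q * Cu * Cv"] conjI ballI)
    show "0 < (K powr p) powr q * Cu * Cv" using Cu Cv K_gt_0 by simp
    fix F :: "'a \<Rightarrow> ennreal" assume [measurable]: "F \<in> borel_measurable lebesgue"
    let ?Mv = "umax V.\<mu> (\<lambda>z. F z / v z)"
    define G where "G = (\<lambda>y. ?Mv y epowr (p - 1) / u y)"
    have [measurable]: "?Mv \<in> borel_measurable lebesgue"
      using V.borel_measurable_umax by (simp add: measurable_def)
    have [measurable]: "G \<in> borel_measurable lebesgue"
      unfolding G_def by measurable
    have [measurable]: "umax U.\<mu> G \<in> borel_measurable lebesgue"
      using U.borel_measurable_umax by (simp add: measurable_def)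
    define H where "H = (\<lambda>x. (ennreal (K powr p) * umax U.\<mu> G x) epowr (1 / (p - 1)))"
    have [measurable]: "H \<in> borel_measurable lebesgue"
      unfolding H_def by measurable
    have "(\<integral>\<^sup>+ x. H x epowr p * u x \<partial>lebesgue)
      = (\<integral>\<^sup>+ x. ennreal ((K powr p) powr q) * (u x * umax U.\<mu> G x epowr q) \<partial>lebesgue)"
    proof (rule nn_integral_cong)
      fix x
      have "H x epowr p = (ennreal (K powr p) * umax U.\<mu> G x) epowr (1 / (p - 1) * p)"
        unfolding H_def using p1 by (intro epowr_epowr) auto
      also have "\<dots> = ennreal ((K powr p) powr q) * umax U.\<mu> G x epowr q"
        using p1 K_gt_0 by (simp only: epowr_mult epowr_ennreal powr_gt_zero)
      finally show "H x epowr p * u x = ennreal ((K powr p) powr q) * (u x * umax U.\<mu> G x epowr q)"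
        by (simp add: mult_ac)
    qed
    also have "\<dots> = ennreal ((K powr p) powr q) * (\<integral>\<^sup>+ x. umax U.\<mu> G x epowr q \<partial>U.\<mu>)"
      by (subst nn_integral_cmult) (auto simp: nn_integral_density)
    also have "\<dots> \<le> ennreal ((K powr p) powr q) * (ennreal Cu * (\<integral>\<^sup>+ x. G x epowr q \<partial>U.\<mu>))"
      by (intro mult_left_mono Cu(2)) auto
    \<comment> \<open>As (p-1) q = p, the relation u^(1-q) = v moves the integral from the weight
      \<open>u\<close> to the weight \<open>v\<close>.\<close>
    also have "(\<integral>\<^sup>+ x. G x epowr q \<partial>U.\<mu>) = (\<integral>\<^sup>+ x. ?Mv x epowr p \<partial>V.\<mu>)"
    proof -
      have "(\<integral>\<^sup>+ x. u x * G x epowr q \<partial>lebesgue) = (\<integral>\<^sup>+ x. v x * ?Mv x epowr p \<partial>lebesgue)"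
      proof (rule nn_integral_cong_AE)
        show "AE x in lebesgue. u x * G x epowr q = v x * ?Mv x epowr p"
          using AE_quotient_power
          by eventually_elim (use p1 in \<open>simp add: G_def mult.commute epowr_epowr\<close>)
      qed
      then show ?thesis by (simp add: nn_integral_density)
    qed
    also have "ennreal ((K powr p) powr q) * (ennreal Cu * \<dots>)
      \<le> ennreal ((K powr p) powr q) * (ennreal Cu * (ennreal Cv * (\<integral>\<^sup>+ x. (F x / v x) epowr p \<partial>V.\<mu>)))"
      by (intro mult_left_mono Cv(2)) auto
    \<comment> \<open>The swapped relation v^(1-p) = u leads back to the weight
      \<open>u\<close>.\<close>
    also have "(\<integral>\<^sup>+ x. (F x / v x) epowr p \<partial>V.\<mu>) = (\<integral>\<^sup>+ x. F x epowr p * u x \<partial>lebesgue)"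
    proof -
      have "(\<integral>\<^sup>+ x. v x * (F x / v x) epowr p \<partial>lebesgue) = (\<integral>\<^sup>+ x. F x epowr p * u x \<partial>lebesgue)"
      proof (rule nn_integral_cong_AE)
        show "AE x in lebesgue. v x * (F x / v x) epowr p = F x epowr p * u x"
          using dual.AE_quotient_power by eventually_elim (simp add: mult.commute)
      qed
      then show ?thesis by (simp add: nn_integral_density)
    qed
    finally have "(\<integral>\<^sup>+ x. H x epowr p * u x \<partial>lebesgue)
      \<le> ennreal ((K powr p) powr q * Cu * Cv) * (\<integral>\<^sup>+ x. F x epowr p * u x \<partial>lebesgue)"
      using Cu Cv by (simp add: ennreal_mult mult.assoc)
    moreover have "\<forall>x. hl_max F x \<le> H x"
      by (simp add: H_def G_def hl_max_le_umax)
    ultimately show "\<exists>H\<in>borel_measurable lebesgue. (\<forall>x. hl_max F x \<le> H x) \<and>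
      (\<integral>\<^sup>+ x. H x epowr p * u x \<partial>lebesgue)
        \<le> ennreal ((K powr p) powr q * Cu * Cv) * (\<integral>\<^sup>+ x. F x epowr p * u x \<partial>lebesgue)"
      by (intro bexI[of _ H]) auto
  qed
qed

end

subsection \<open>Morrey-type bounds and the Muckenhoupt classes\<close>

context averaging_weight begin

text \<open>The supremum covers the radius \<open>t = 5 * r\<close>, and doubling replaces the
  measure of that ball by the measure of \<open>ball a r\<close>.\<close>

lemma norm_dilated_ball:
  assumes r: "0 < r"
  shows "(\<integral>\<^sup>+ x. (F x * indicator (ball a (5 * r)) x) epowr p * u x \<partial>lebesgue)
    \<le> ennreal ((K * 5 ^ DIM('a)) powr p) * emeasure \<mu> (ball a r) * sup_average F a r epowr p"
proof -
  have p: "0 < p" using p_ge_1 by simp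
  have "(\<integral>\<^sup>+ x. (F x * indicator (ball a (5 * r)) x) epowr p * u x \<partial>lebesgue)
      = ((\<integral>\<^sup>+ x\<in>ball a (5 * r). F x epowr p * u x \<partial>lebesgue) epowr (1 / p)) epowr p"
    using p by (simp add: root_epowr) (auto intro!: nn_integral_cong simp: indicator_def)
  also have "\<dots> \<le> (emeasure \<mu> (ball a (5 * r)) epowr (1 / p) * sup_average F a r) epowr p"
    using r p by (intro epowr_mono norm_le_sup_average) auto
  also have "\<dots> = emeasure \<mu> (ball a (5 * r)) * sup_average F a r epowr p"
    using p by (simp add: epowr_mult root_epowr)
  also have "\<dots> \<le> ennreal ((K * 5 ^ DIM('a)) powr p) * emeasure \<mu> (ball a r) * sup_average F a r epowr p"
    by (intro mult_right_mono doubling r) auto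
  finally show ?thesis .
qed

end

context dual_weights begin

text \<open>On \<open>ball a r\<close>, \<open>hl_max_local\<close> leaves the maximal function of
  the truncation to \<open>ball a (5 * r)\<close>, treated by the strong bound, and a constant. They
  contribute \<open>C * D\<close> and \<open>D\<close> to the constant before the root is
  taken.\<close>

theorem hl_max_morrey:
  "\<exists>C>0. \<forall>F\<in>borel_measurable lebesgue. \<forall>a r. 0 < r \<longrightarrow>
    (\<integral>\<^sup>+ x\<in>ball a r. hl_max F x epowr p * u x \<partial>lebesgue) epowr (1 / p)
      \<le> ennreal C * emeasure (density lebesgue u) (ball a r) epowr (1 / p) * averaging_weight.sup_average u p F a r"
proof -
  interpret U: averaging_weight u p K by (rule averaging_u)
  have p: "0 < p" using exponents by simp
  obtain C where C: "0 < C" "\<And>F. F \<in> borel_measurable lebesgue \<Longrightarrow> \<exists>H\<in>borel_measurable lebesgue.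
     (\<forall>x. hl_max F x \<le> H x) \<and>
     (\<integral>\<^sup>+ x. H x epowr p * u x \<partial>lebesgue) \<le> ennreal C * (\<integral>\<^sup>+ x. F x epowr p * u x \<partial>lebesgue)"
    using hl_max_strong by blast
  define D where "D = (K * 5 ^ DIM('a)) powr p"
  have D: "0 < D" using K_gt_0 by (simp add: D_def)
  show ?thesis
  proof (intro exI[of _ "(C * D + D) powr (1 / p)"] conjI ballI allI impI)
    have CD: "0 < C * D + D" using C D by (intro add_pos_pos mult_pos_pos)
    then show "0 < (C * D + D) powr (1 / p)" by (metis less_irrefl powr_gt_zero)
    fix F :: "'a \<Rightarrow> ennreal" and a :: 'a and r :: real
    assume [measurable]: "F \<in> borel_measurable lebesgue" and r: "0 < r"
    let ?S = "U.sup_average F a r" and ?U = "emeasure U.\<mu> (ball a r)"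
    let ?F = "\<lambda>x. F x * indicator (ball a (5 * r)) x"
    obtain H where [measurable]: "H \<in> borel_measurable lebesgue" and H: "\<And>x. hl_max ?F x \<le> H x"
      "(\<integral>\<^sup>+ x. H x epowr p * u x \<partial>lebesgue) \<le> ennreal C * (\<integral>\<^sup>+ x. ?F x epowr p * u x \<partial>lebesgue)"
      using C(2)[of ?F] by auto
    \<comment> \<open>The majorant \<open>H\<close> and the constant term are measurable, so the
      integral of their sum splits.\<close>
    have "(\<integral>\<^sup>+ x\<in>ball a r. hl_max F x epowr p * u x \<partial>lebesgue)
      \<le> (\<integral>\<^sup>+ x. H x epowr p * u x + ennreal D * ?S epowr p * (u x * indicator (ball a r) x) \<partial>lebesgue)"
    proof (rule nn_integral_mono)
      fix x
      show "hl_max F x epowr p * u x * indicator (ball a r) x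
        \<le> H x epowr p * u x + ennreal D * ?S epowr p * (u x * indicator (ball a r) x)"
      proof (cases "x \<in> ball a r")
        case True
        have "hl_max F x \<le> max (hl_max ?F x) (ennreal (K * 5 ^ DIM('a)) * ?S)"
          by (rule U.hl_max_local) (use True in auto)
        also have "\<dots> \<le> max (H x) (ennreal (K * 5 ^ DIM('a)) * ?S)"
          using H(1) by (intro max.mono) auto
        finally have "hl_max F x epowr p \<le> max (H x) (ennreal (K * 5 ^ DIM('a)) * ?S) epowr p"
          using p by (intro epowr_mono)
        also have "\<dots> \<le> H x epowr p + (ennreal (K * 5 ^ DIM('a)) * ?S) epowr p"
          by (simp add: max_def)
        also have "(ennreal (K * 5 ^ DIM('a)) * ?S) epowr p = ennreal D * ?S epowr p"
          using p K_gt_0 by (simp add: epowr_mult epowr_ennreal D_def)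
        finally have "hl_max F x epowr p * u x \<le> (H x epowr p + ennreal D * ?S epowr p) * u x"
          by (rule mult_right_mono) simp
        then show ?thesis using True by (simp add: distrib_right)
      qed simp
    qed
    also have "\<dots> = (\<integral>\<^sup>+ x. H x epowr p * u x \<partial>lebesgue) + ennreal D * ?S epowr p * ?U"
      by (subst nn_integral_add) (auto simp: nn_integral_cmult emeasure_density)
    also have "\<dots> \<le> ennreal C * (ennreal D * ?U * ?S epowr p) + ennreal D * ?S epowr p * ?U"
      unfolding D_def by (intro add_right_mono order_trans[OF H(2)] mult_left_mono U.norm_dilated_ball r) simp
    also have "\<dots> = ennreal (C * D + D) * (?U * ?S epowr p)"
      using C D by (simp add: ennreal_mult distrib_left distrib_right mult_ac)
    finally have "(\<integral>\<^sup>+ x\<in>ball a r. hl_max F x epowr p * u x \<partial>lebesgue) epowr (1 / p)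
        \<le> (ennreal (C * D + D) * (?U * ?S epowr p)) epowr (1 / p)"
      using p by (intro epowr_mono) auto
    also have "\<dots> = ennreal ((C * D + D) powr (1 / p)) * ?U epowr (1 / p) * ?S"
      using p C D by (simp add: epowr_mult epowr_root epowr_ennreal[OF CD] mult.assoc del: ennreal_plus)
    finally show "(\<integral>\<^sup>+ x\<in>ball a r. hl_max F x epowr p * u x \<partial>lebesgue) epowr (1 / p)
      \<le> ennreal ((C * D + D) powr (1 / p)) * ?U epowr (1 / p) * ?S" .
  qed
qed

end

text \<open>Levels below \<open>D * ?S\<close> are harmless since the superlevel set lies in
  \<open>ball a r\<close>; above them only the truncation to \<open>ball a (5 * r)\<close> counts,
  and its maximal function is dominated by \<open>K\<close> times \<open>umax\<close>, which has
  weak type (1,1).\<close>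

theorem hl_max_morrey_weak:
  fixes u :: "'a::euclidean_space \<Rightarrow> ennreal"
  assumes "averaging_weight u 1 K"
  shows "\<exists>C>0. \<forall>F\<in>borel_measurable lebesgue. \<forall>a r. \<forall>t>0. 0 < r \<longrightarrow>
    ennreal t * (\<integral>\<^sup>+ x\<in>{x \<in> ball a r. ennreal t < hl_max F x}. u x \<partial>lebesgue)
      \<le> ennreal C * emeasure (density lebesgue u) (ball a r) * averaging_weight.sup_average u 1 F a r"
proof -
  interpret averaging_weight u 1 K by fact
  define D where "D = K * 5 ^ DIM('a)"
  have D: "0 < D" using K_pos by (simp add: D_def)
  \<comment> \<open>For \<open>p = 1\<close> the averaging inequality compares a Lebesgue average
    with an average against \<open>\<mu>\<close> over the same ball.\<close>
  have max_le: "hl_max F x \<le> ennreal K * umax \<mu> F x" if [measurable]: "F \<in> borel_measurable lebesgue" for F x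
  proof (rule hl_max_le)
    fix r :: real assume r: "0 < r"
    let ?U = "emeasure \<mu> (ball x r)" and ?L = "emeasure lebesgue (ball x r)"
    have "?U * (\<integral>\<^sup>+ y\<in>ball x r. F y \<partial>lebesgue) \<le> ennreal K * ?L * (\<integral>\<^sup>+ y\<in>ball x r. F y * u y \<partial>lebesgue)"
      using averaging[OF r, of F x] by simp
    also have "(\<integral>\<^sup>+ y\<in>ball x r. F y * u y \<partial>lebesgue) = (\<integral>\<^sup>+ y\<in>ball x r. F y \<partial>\<mu>)"
      by (subst nn_integral_density) (auto simp: mult_ac)
    also have "ennreal K * ?L * \<dots> \<le> ennreal K * ?L * (umax \<mu> F x * ?U)"
      using r by (intro mult_left_mono average_le_umax) auto
    finally have "?U * (\<integral>\<^sup>+ y\<in>ball x r. F y \<partial>lebesgue) \<le> ?U * (?L * (ennreal K * umax \<mu> F x))"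
      by (simp add: mult_ac)
    then show "(\<integral>\<^sup>+ y\<in>ball x r. F y \<partial>lebesgue) \<le> ?L * (ennreal K * umax \<mu> F x)"
      using weight_pos[OF r, of x] weight_finite[of x r] by (subst (asm) ennreal_mult_le_mult_iff) auto
  qed
  show ?thesis
  \<comment> \<open>In \<open>K * D * D\<close>, \<open>K\<close> comes from the level
    \<open>t / K\<close>, one \<open>D\<close> from the weak bound and one from
    \<open>norm_dilated_ball\<close>; the last \<open>D\<close> covers the low levels.\<close>
  proof (intro exI[of _ "K * D * D + D"] conjI ballI allI impI)
    show "0 < K * D * D + D" using D K_pos by (simp add: add_pos_pos)
    fix F :: "'a \<Rightarrow> ennreal" and a :: 'a and r t :: real
    assume [measurable]: "F \<in> borel_measurable lebesgue" and r: "0 < r" and t: "0 < t"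
    let ?S = "sup_average F a r" and ?U = "emeasure \<mu> (ball a r)"
    let ?F = "\<lambda>x. F x * indicator (ball a (5 * r)) x"
    let ?E = "{x \<in> ball a r. ennreal t < hl_max F x}"
    have C: "ennreal (K * D * D + D) * ?U * ?S = ennreal K * (ennreal D * (ennreal D * ?U * ?S)) + ennreal D * ?S * ?U"
      using D K_pos by (simp add: ennreal_mult distrib_left distrib_right mult_ac)
    show "ennreal t * (\<integral>\<^sup>+ x\<in>?E. u x \<partial>lebesgue) \<le> ennreal (K * D * D + D) * ?U * ?S"
    proof (cases "ennreal t < ennreal D * ?S")
      case True
      have "(\<integral>\<^sup>+ x\<in>?E. u x \<partial>lebesgue) \<le> ?U"
        by (subst emeasure_density) (auto intro!: nn_integral_mono simp: indicator_def)
      then have "ennreal t * (\<integral>\<^sup>+ x\<in>?E. u x \<partial>lebesgue) \<le> ennreal D * ?S * ?U"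
        using True by (intro mult_mono) auto
      then show ?thesis unfolding C by (rule order_trans) simp
    next
      case False
      let ?W = "{x. ennreal (t / K) < umax \<mu> ?F x}"
      have "x \<in> ?W" if "x \<in> ?E" for x
      proof -
        have "hl_max F x \<le> max (hl_max ?F x) (ennreal D * ?S)"
          unfolding D_def by (rule hl_max_local) (use that in auto)
        then have "ennreal t < hl_max ?F x"
          using that False by (auto simp: max_def not_less split: if_splits)
        also have "\<dots> \<le> ennreal K * umax \<mu> ?F x" by (rule max_le) measurable
        finally have less: "ennreal K * ennreal (t / K) < ennreal K * umax \<mu> ?F x"
          using K_pos t by (simp flip: ennreal_mult)
        show "x \<in> ?W"
          using less mult_left_mono[of "umax \<mu> ?F x" "ennreal (t / K)" "ennreal K"]
          by (metis (lifting) linorder_not_less mem_Collect_eq zero_le)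
      qed
      \<comment> \<open>Comparing integrands makes no claim about the measurability of
        \<open>?E\<close>, whereas \<open>?W\<close> is open.\<close>
      then have "(\<integral>\<^sup>+ x\<in>?E. u x \<partial>lebesgue) \<le> (\<integral>\<^sup>+ x\<in>?W. u x \<partial>lebesgue)"
        by (intro nn_integral_mono) (auto simp: indicator_def)
      also have "\<dots> = emeasure \<mu> ?W"
        using open_umax by (subst emeasure_density) (auto simp: borel_open)
      finally have "ennreal t * (\<integral>\<^sup>+ x\<in>?E. u x \<partial>lebesgue) \<le> ennreal t * emeasure \<mu> ?W"
        by (rule mult_left_mono) simp
      also have "\<dots> = ennreal K * (ennreal (t / K) * emeasure \<mu> ?W)"
        using K_pos t by (simp add: mult.assoc[symmetric] flip: ennreal_mult)
      also have "\<dots> \<le> ennreal K * (ennreal ((K * 5 ^ DIM('a)) powr 1) * (\<integral>\<^sup>+ x. ?F x \<partial>\<mu>))"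
        by (intro mult_left_mono umax_weak) auto
      also have "(\<integral>\<^sup>+ x. ?F x \<partial>\<mu>) = (\<integral>\<^sup>+ x. ?F x epowr 1 * u x \<partial>lebesgue)"
        by (subst nn_integral_density) (auto simp: mult_ac)
      also have "ennreal K * (ennreal ((K * 5 ^ DIM('a)) powr 1) * \<dots>)
          \<le> ennreal K * (ennreal ((K * 5 ^ DIM('a)) powr 1) *
            (ennreal ((K * 5 ^ DIM('a)) powr 1) * ?U * ?S epowr 1))"
        by (intro mult_left_mono norm_dilated_ball r) auto
      also have "\<dots> = ennreal K * (ennreal D * (ennreal D * ?U * ?S))"
        using K_pos by (simp add: D_def)
      finally show ?thesis unfolding C by (rule order_trans) simp
    qed
  qed
qed

section \<open>From the Muckenhoupt classes to averaging inequalities\<close>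

lemma density_ball_pos:
  fixes u :: "'a::euclidean_space \<Rightarrow> ennreal"
  assumes [measurable]: "u \<in> borel_measurable lebesgue" and "AE x in lebesgue. 0 < u x" and "0 < r"
  shows "0 < emeasure (density lebesgue u) (ball c r)"
proof (rule ccontr)
  assume "\<not> ?thesis"
  then have "(\<integral>\<^sup>+ x. u x * indicator (ball c r) x \<partial>lebesgue) = 0"
    by (simp add: emeasure_density)
  then have "AE x in lebesgue. u x * indicator (ball c r) x = 0"
    by (subst (asm) nn_integral_0_iff_AE) auto
  with assms(2) have "AE x in lebesgue. x \<notin> ball c r"
    by eventually_elim (auto simp: indicator_def split: if_splits)
  then have "emeasure lebesgue (ball c r) = 0"
    by (subst (asm) AE_iff_measurable[of "ball c r"]) auto
  then show False using emeasure_ball_pos[OF assms(3), of c] by simp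
qed

lemma weight_density_finite:
  assumes "weight w"
  shows "emeasure (density lebesgue (\<lambda>x. ennreal (w x))) (ball c r) < top"
proof -
  have [measurable]: "w \<in> borel_measurable lebesgue" and int: "integrable lebesgue (\<lambda>x. indicator (ball c r) x *\<^sub>R w x)"
    and nonneg: "\<And>x. 0 \<le> w x"
    using assms by (auto simp: weight_def set_integrable_def)
  have "emeasure (density lebesgue (\<lambda>x. ennreal (w x))) (ball c r)
      = (\<integral>\<^sup>+ x. ennreal (norm (indicator (ball c r) x *\<^sub>R w x)) \<partial>lebesgue)"
    using nonneg by (subst emeasure_density) (auto intro!: nn_integral_cong simp: indicator_def)
  also have "\<dots> < top"
    using int by (simp add: integrable_iff_bounded infinity_ennreal_def)
  finally show ?thesis .
qed

text \<open>Almost everywhere on a ball, \<open>w\<close> times the essential supremum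
  \<open>?E\<close> of 1/w is at least 1, so \<open>F\<close> is at most \<open>?E\<close> F w; the
  A_1 condition bounds \<open>?U * ?E\<close>.\<close>

lemma A1_averaging_weight:
  assumes "w \<in> Ap_class 1"
  obtains K where "averaging_weight (\<lambda>x. ennreal (w x)) 1 K"
proof -
  let ?u = "\<lambda>x. ennreal (w x)"
  have w: "weight w" using assms by (simp add: Ap_class_def)
  then have [measurable]: "w \<in> borel_measurable lebesgue" and pos: "AE x in lebesgue. 0 < w x"
    by (auto simp: weight_def)
  obtain C where C: "\<And>c \<rho>. 0 < \<rho> \<Longrightarrow> eavg (ball c \<rho>) ?u
       * esssup (restrict_space lebesgue (ball c \<rho>)) (\<lambda>x. inverse (?u x)) \<le> ennreal C"
    using assms by (auto simp: Ap_class_def)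
  \<comment> \<open>The maximum with 1 provides the positive constant that the locale
    demands.\<close>
  have "averaging_weight ?u 1 (max C 1)"
  proof
    fix r :: real and c :: 'a and F :: "'a \<Rightarrow> ennreal"
    assume r: "0 < r" and [measurable]: "F \<in> borel_measurable lebesgue"
    let ?B = "ball c r"
    let ?U = "emeasure (density lebesgue ?u) ?B" and ?L = "emeasure lebesgue ?B"
    let ?E = "esssup (restrict_space lebesgue ?B) (\<lambda>x. inverse (?u x))"
    have U: "?U = (\<integral>\<^sup>+ x\<in>?B. ?u x \<partial>lebesgue)"
      by (subst emeasure_density) auto
    have "?U / ?L * ?E \<le> ennreal (max C 1)"
      using C[OF r, of c] unfolding eavg_def U by (rule order_trans) (simp add: ennreal_leI)
    then have "?U / ?L * ?E * ?L \<le> ennreal (max C 1) * ?L"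
      by (rule mult_right_mono) simp
    moreover have "?U / ?L * ?L = ?U"
      using emeasure_ball_pos[OF r, of c] emeasure_ball_finite[of c r]
      by (simp add: ennreal_divide_times)
    ultimately have UE: "?U * ?E \<le> ennreal (max C 1) * ?L"
      by (metis mult.assoc mult.commute)
    have "AE x in restrict_space lebesgue ?B. inverse (?u x) \<le> ?E"
      by (rule esssup_AE)
    then have "AE x in lebesgue. x \<in> ?B \<longrightarrow> inverse (?u x) \<le> ?E"
      by (subst (asm) AE_restrict_space_iff) auto
    with pos have "AE x in lebesgue. F x * indicator ?B x \<le> ?E * (F x * ?u x * indicator ?B x)"
    proof eventually_elim
      case (elim x)
      show ?case
      proof (cases "x \<in> ?B")
        case True
        have "F x = F x * ?u x * inverse (?u x)"
          using elim(1) by (simp add: mult.assoc inverse_ennreal flip: ennreal_mult)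
        also have "\<dots> \<le> F x * ?u x * ?E"
          using elim(2) True by (intro mult_left_mono) auto
        finally show ?thesis using True by (simp add: mult_ac)
      qed simp
    qed
    then have "(\<integral>\<^sup>+ x\<in>?B. F x \<partial>lebesgue) \<le> (\<integral>\<^sup>+ x. ?E * (F x * ?u x * indicator ?B x) \<partial>lebesgue)"
      by (rule nn_integral_mono_AE)
    also have "\<dots> = ?E * (\<integral>\<^sup>+ x\<in>?B. F x * ?u x \<partial>lebesgue)"
      by (rule nn_integral_cmult) measurable
    finally have "?U * (\<integral>\<^sup>+ x\<in>?B. F x \<partial>lebesgue) \<le> ?U * (?E * (\<integral>\<^sup>+ x\<in>?B. F x * ?u x \<partial>lebesgue))"
      by (rule mult_left_mono) simp
    also have "\<dots> \<le> ennreal (max C 1) * ?L * (\<integral>\<^sup>+ x\<in>?B. F x * ?u x \<partial>lebesgue)"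
      unfolding mult.assoc[of ?U, symmetric] by (intro mult_right_mono UE) simp
    finally show "?U epowr (1 / 1) * (\<integral>\<^sup>+ x\<in>?B. F x \<partial>lebesgue)
      \<le> ennreal (max C 1) * ?L * (\<integral>\<^sup>+ x\<in>?B. F x epowr 1 * ?u x \<partial>lebesgue) epowr (1 / 1)"
      by simp
  qed (use w pos in \<open>auto intro!: density_ball_pos weight_density_finite\<close>)
  then show ?thesis by (rule that)
qed

text \<open>Clearing denominators in the A_p condition and taking the \<open>p\<close>-th root
  yields the symmetric form, so \<open>K\<close> is the \<open>p\<close>-th root of
  \<open>max C 1\<close>.\<close>

lemma Ap_dual_weights:
  assumes "w \<in> Ap_class p" and p: "1 < p"
  obtains K where "dual_weights (\<lambda>x. ennreal (w x)) (\<lambda>x. ennreal (w x) epowr (- 1 / (p - 1))) p (p / (p - 1)) K"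
proof -
  let ?u = "\<lambda>x. ennreal (w x)"
  let ?v = "\<lambda>x. ennreal (w x) epowr (- 1 / (p - 1))"
  have w: "weight w" using assms by (simp add: Ap_class_def)
  then have [measurable]: "w \<in> borel_measurable lebesgue" and pos: "AE x in lebesgue. 0 < w x"
    by (auto simp: weight_def)
  obtain C where C: "\<And>c \<rho>. 0 < \<rho> \<Longrightarrow> eavg (ball c \<rho>) ?u * eavg (ball c \<rho>) ?v epowr (p - 1) \<le> ennreal C"
    using assms by (auto simp: Ap_class_def)
  let ?U = "\<lambda>c r. emeasure (density lebesgue ?u) (ball c r)"
  let ?V = "\<lambda>c r. emeasure (density lebesgue ?v) (ball c r)"
  let ?L = "\<lambda>c r. emeasure lebesgue (ball (c::'a) r)"
  have U: "?U c r = (\<integral>\<^sup>+ x\<in>ball c r. ?u x \<partial>lebesgue)" for c r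
    by (subst emeasure_density) auto
  have V: "?V c r = (\<integral>\<^sup>+ x\<in>ball c r. ?v x \<partial>lebesgue)" for c r
    by (subst emeasure_density) auto
  have UV: "?U c r / ?L c r * (?V c r / ?L c r) epowr (p - 1) \<le> ennreal (max C 1)" if "0 < r" for c r
    using C[OF that, of c] unfolding eavg_def U V by (rule order_trans) (simp add: ennreal_leI)
  have L: "0 < ?L c r" "?L c r < top" if "0 < r" for c r
    using that emeasure_ball_pos emeasure_ball_finite by auto
  have Upos: "0 < ?U c r" if "0 < r" for c r
    using that pos by (intro density_ball_pos) auto
  have "dual_weights ?u ?v p (p / (p - 1)) (max C 1 powr (1 / p))"
  proof
    show "AE x in lebesgue. ?u x \<noteq> top \<and> ?v x \<noteq> top \<and> ?u x epowr (1 / p) * ?v x epowr (1 / (p / (p - 1))) = 1"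
      using pos
    proof eventually_elim
      case (elim x)
      have "w x powr (1 / p) * (w x powr (- 1 / (p - 1))) powr (1 / (p / (p - 1))) = w x powr (1 / p + (- 1 / (p - 1)) * (1 / (p / (p - 1))))"
        by (simp only: powr_powr powr_add)
      also have "1 / p + (- 1 / (p - 1)) * (1 / (p / (p - 1))) = 0"
        using p by (simp add: field_simps)
      finally show ?case
        using elim p by (simp add: epowr_ennreal flip: ennreal_mult)
    qed
    fix c :: 'a and r :: real
    show "0 < ?U c r" if "0 < r" using that by (rule Upos)
    show "0 < ?V c r" if "0 < r"
    proof (rule density_ball_pos)
      show "AE x in lebesgue. 0 < ?v x"
        using pos by eventually_elim (simp add: epowr_ennreal)
    qed (use that in auto)
    show "?U c r < top" by (rule weight_density_finite[OF w])
    show "?V c r < top"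
    proof (cases "0 < r")
      case True
      \<comment> \<open>Finiteness of the dual weight on balls follows from A_p: the average of
        \<open>w\<close> is positive, so a finite product forces a finite second factor.\<close>
      have "?U c r / ?L c r \<noteq> 0"
        using Upos[OF True, of c] L[OF True, of c] by (auto dest: less_imp_neq)
      then have "(?V c r / ?L c r) epowr (p - 1) \<noteq> top"
        using UV[OF True, of c] by (auto simp: top_unique ennreal_mult_top)
      then have "?V c r / ?L c r \<noteq> top" using p by auto
      then show ?thesis
        using L[OF True, of c] by (auto simp: ennreal_divide_eq_top_iff simp flip: less_top)
    qed (simp add: ball_empty)
    show "?U c r epowr (1 / p) * ?V c r epowr (1 / (p / (p - 1))) \<le> ennreal (max C 1 powr (1 / p)) * ?L c r"
      if r: "0 < r"
    proof -
      have eq: "?U c r / ?L c r * ?L c r = ?U c r" "?V c r / ?L c r * ?L c r = ?V c r"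
        using L[OF r, of c] by (simp_all add: ennreal_divide_times)
      \<comment> \<open>Each measure is an average times \<open>?L c r\<close>; the volume factors
        collect to its \<open>p\<close>-th power.\<close>
      have "?U c r * ?V c r epowr (p - 1) = ?U c r / ?L c r * ?L c r * (?V c r / ?L c r * ?L c r) epowr (p - 1)"
        by (simp only: eq)
      also have "\<dots> = (?U c r / ?L c r * (?V c r / ?L c r) epowr (p - 1)) * (?L c r * ?L c r epowr (p - 1))"
        using p by (simp only: epowr_mult diff_gt_0_iff_gt mult_ac)
      also have "?L c r * ?L c r epowr (p - 1) = ?L c r epowr p"
        using p epowr_add[of 1 "p - 1" "?L c r"] by simp
      also have "(?U c r / ?L c r * (?V c r / ?L c r) epowr (p - 1)) * ?L c r epowr p \<le> ennreal (max C 1) * ?L c r epowr p"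
        by (intro mult_right_mono UV r) simp
      finally have "(?U c r * ?V c r epowr (p - 1)) epowr (1 / p) \<le> (ennreal (max C 1) * ?L c r epowr p) epowr (1 / p)"
        using p by (intro epowr_mono) auto
      moreover have "(?U c r * ?V c r epowr (p - 1)) epowr (1 / p) = ?U c r epowr (1 / p) * ?V c r epowr (1 / (p / (p - 1)))"
        using p by (simp add: epowr_mult epowr_epowr)
      moreover have "(ennreal (max C 1) * ?L c r epowr p) epowr (1 / p) = ennreal (max C 1 powr (1 / p)) * ?L c r"
        using p by (subst epowr_mult) (simp_all add: epowr_root epowr_ennreal)
      ultimately show ?thesis by simp
    qed
  qed (use p in \<open>auto simp: field_simps\<close>)
  then show ?thesis by (rule that)
qed

section \<open>Strong and weak local estimates for Muckenhoupt weights\<close>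

theorem theorem3p1:
  fixes p :: real and w :: "'a::euclidean_space \<Rightarrow> real"
  assumes "1 \<le> p" and "w \<in> Ap_class p"
  shows "\<exists>C1 C2 :: real. C1 > 0 \<and> C2 > 0 \<and>
    (\<forall>(a::'a) r. r > 0 \<longrightarrow>
      (1 < p \<longrightarrow> (\<forall>f \<in> Lpw_loc p w.
         Lpw_norm p w (ball a r) (maxfun f)
           \<le> ennreal C1 * (wmeas w (ball a r)) epowr (1 / p)
              * (SUP t\<in>{r<..}. (wmeas w (ball a t)) epowr (- 1 / p)
                                * Lpw_norm p w (ball a t) (\<lambda>x. ennreal \<bar>f x\<bar>)))) \<and>
      (p = 1 \<longrightarrow> (\<forall>f \<in> Lpw_loc 1 w.
         WLpw_norm 1 w (ball a r) (maxfun f)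
           \<le> ennreal C2 * wmeas w (ball a r)
              * (SUP t\<in>{r<..}. (wmeas w (ball a t)) epowr (- 1)
                                * Lpw_norm 1 w (ball a t) (\<lambda>x. ennreal \<bar>f x\<bar>)))))"
proof -
  let ?u = "\<lambda>x. ennreal (w x)"
  have [measurable]: "w \<in> borel_measurable lebesgue"
    using assms by (auto simp: Ap_class_def weight_def)
  have wmeas: "wmeas w (ball c s) = emeasure (density lebesgue ?u) (ball c s)" for c s
    by (simp add: wmeas_def emeasure_density)
  have maxfun: "maxfun f = hl_max (\<lambda>x. ennreal \<bar>f x\<bar>)" for f :: "'a \<Rightarrow> real"
    by (simp add: maxfun_def hl_max_def fun_eq_iff)
  have abs_meas: "(\<lambda>x. ennreal \<bar>f x\<bar>) \<in> borel_measurable lebesgue" if "f \<in> Lpw_loc s w" for f s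
  proof -
    have [measurable]: "f \<in> borel_measurable lebesgue" using that by (simp add: Lpw_loc_def)
    show ?thesis by measurable
  qed
  show ?thesis
  proof (cases "p = 1")
    case True
    with assms obtain K where K: "averaging_weight ?u 1 K"
      using A1_averaging_weight by blast
    obtain C where C: "0 < C" "\<And>F a r t. F \<in> borel_measurable lebesgue \<Longrightarrow> 0 < t \<Longrightarrow> 0 < r \<Longrightarrow>
        ennreal t * (\<integral>\<^sup>+ x\<in>{x \<in> ball a r. ennreal t < hl_max F x}. ?u x \<partial>lebesgue)
        \<le> ennreal C * emeasure (density lebesgue ?u) (ball a r) * averaging_weight.sup_average ?u 1 F a r"
      using hl_max_morrey_weak[OF K] by blast
    show ?thesis
    \<comment> \<open>For \<open>p = 1\<close> only the weak inequality is asserted, so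
      \<open>C1\<close> takes the default value 1.\<close>
    proof (rule exI[of _ 1], rule exI[of _ C], intro conjI allI impI ballI)
      fix a :: 'a and r :: real and f assume r: "0 < r" and f: "f \<in> Lpw_loc 1 w"
      show "WLpw_norm 1 w (ball a r) (maxfun f) \<le> ennreal C * wmeas w (ball a r)
        * (SUP t\<in>{r<..}. (wmeas w (ball a t)) epowr (- 1) * Lpw_norm 1 w (ball a t) (\<lambda>x. ennreal \<bar>f x\<bar>))"
        unfolding WLpw_norm_def
      proof (rule SUP_least)
        fix t :: real assume "t \<in> {0<..}"
        then show "ennreal t * wmeas w {x \<in> ball a r. ennreal t < maxfun f x} epowr (1 / 1)
          \<le> ennreal C * wmeas w (ball a r)
            * (SUP t\<in>{r<..}. (wmeas w (ball a t)) epowr (- 1) * Lpw_norm 1 w (ball a t) (\<lambda>x. ennreal \<bar>f x\<bar>))"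
          using C(2)[OF abs_meas[OF f], of t r a] r
          by (simp add: maxfun wmeas averaging_weight.sup_average_def[OF K] Lpw_norm_def)
            (simp add: wmeas_def)
      qed
    qed (use True C in auto)
  next
    case False
    then have p: "1 < p" using assms by simp
    obtain K where K: "dual_weights ?u (\<lambda>x. ennreal (w x) epowr (- 1 / (p - 1))) p (p / (p - 1)) K"
      using Ap_dual_weights[OF assms(2) p] by blast
    note avg = dual_weights.averaging_u[OF K]
    obtain C where C: "0 < C" "\<And>F a r. F \<in> borel_measurable lebesgue \<Longrightarrow> 0 < r \<Longrightarrow>
        (\<integral>\<^sup>+ x\<in>ball a r. hl_max F x epowr p * ?u x \<partial>lebesgue) epowr (1 / p)
        \<le> ennreal C * emeasure (density lebesgue ?u) (ball a r) epowr (1 / p) * averaging_weight.sup_average ?u p F a r"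
      using dual_weights.hl_max_morrey[OF K] by blast
    show ?thesis
    \<comment> \<open>For \<open>p > 1\<close> only the strong inequality is asserted, so
      \<open>C2\<close> takes the default value 1.\<close>
    proof (rule exI[of _ C], rule exI[of _ 1], intro conjI allI impI ballI)
      fix a :: 'a and r :: real and f assume r: "0 < r" and f: "f \<in> Lpw_loc p w"
      show "Lpw_norm p w (ball a r) (maxfun f) \<le> ennreal C * wmeas w (ball a r) epowr (1 / p)
        * (SUP t\<in>{r<..}. (wmeas w (ball a t)) epowr (- 1 / p) * Lpw_norm p w (ball a t) (\<lambda>x. ennreal \<bar>f x\<bar>))"
        using C(2)[OF abs_meas[OF f] r, of a]
        by (simp add: maxfun wmeas averaging_weight.sup_average_def[OF avg] Lpw_norm_def)
    qed (use False C in auto)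
  qed
qed

end
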